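(* Fix $p\in[2,\infty)$. Suppose that $m,n\in\mathbb N$ and $k\in\{1,\ldots,n\}$ satisfy $$m\ge \frac{n^{3/2}\log p}{\sqrt{k}}+pn.$$ Then for every $f:\mathbb Z_{4m}^n\to L_p$ we have $$\frac{(p/\log p)^{-p}}{\binom nk}\sum_{\substack{S\subset\{1,\ldots,n\}\\|S|=k}}\frac{\mathbb E\big[\|f(x+2m\varepsilon_S)-f(x)\|_p^p\big]}{m^p}\lesssim_p \frac kn\sum_{j=1}^n\mathbb E\big[\|f(x+e_j)-f(x)\|_p^p\big]+\Big(\frac kn\Big)^{p/2}\mathbb E\big[\|f(x+\varepsilon)-f(x)\|_p^p\big],$$ where the expectations are with respect to $(x,\varepsilon)\in\mathbb Z_{4m}^n\times\{-1,1\}^n$ chosen uniformly at random.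
   Context: $L_p=L_p([0,1])$ with Lebesgue measure and norm $\|\cdot\|_p$. $\mathbb Z_M^n$ is the discrete torus $(\mathbb Z/M\mathbb Z)^n$; integer vectors are added to its elements modulo $M$ coordinatewise. $e_1,\ldots,e_n$ is the standard basis of $\mathbb R^n$, and for $S\subset\{1,\ldots,n\}$ and $\varepsilon\in\{-1,1\}^n$ we write $\varepsilon_S=\sum_{j\in S}\varepsilon_je_j$. Notation: for $a,b\ge0$, $a\lesssim_p b$ means $a\le c^p b$ for some universal constant $c\in(0,\infty)$ (independent of $p,m,n,k,f$). *)

theory Defs
  imports "HOL-Analysis.Analysis" "HOL-Library.FuncSet"
begin

definition torus :: "nat \<Rightarrow> nat \<Rightarrow> (nat \<Rightarrow> int) set" where
  "torus M n = {..<n} \<rightarrow>\<^sub>E {0..<int M}"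

definition signs :: "nat \<Rightarrow> (nat \<Rightarrow> int) set" where
  "signs n = {..<n} \<rightarrow>\<^sub>E {-1, 1}"

definition tadd :: "nat \<Rightarrow> nat \<Rightarrow> (nat \<Rightarrow> int) \<Rightarrow> (nat \<Rightarrow> int) \<Rightarrow> (nat \<Rightarrow> int)" where
  "tadd M n x a = restrict (\<lambda>i. (x i + a i) mod int M) {..<n}"

definition basis_vec :: "nat \<Rightarrow> nat \<Rightarrow> (nat \<Rightarrow> int)" where
  "basis_vec n j = restrict (\<lambda>i. if i = j then 1 else 0) {..<n}"

definition sign_restr :: "nat \<Rightarrow> nat set \<Rightarrow> (nat \<Rightarrow> int) \<Rightarrow> (nat \<Rightarrow> int)" where
  "sign_restr n S eps = restrict (\<lambda>i. if i \<in> S then eps i else 0) {..<n}"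

definition ivec_scale :: "int \<Rightarrow> (nat \<Rightarrow> int) \<Rightarrow> (nat \<Rightarrow> int)" where
  "ivec_scale c a = (\<lambda>i. c * a i)"

definition Lp_norm_pow :: "real \<Rightarrow> (real \<Rightarrow> real) \<Rightarrow> real" where
  "Lp_norm_pow p g = (LINT t:{0..1}|lborel. \<bar>g t\<bar> powr p)"

definition in_Lp :: "real \<Rightarrow> (real \<Rightarrow> real) \<Rightarrow> bool" where
  "in_Lp p g \<longleftrightarrow> g \<in> borel_measurable lborel \<and> set_integrable lborel {0..1} (\<lambda>t. \<bar>g t\<bar> powr p)"

definition avg :: "'a set \<Rightarrow> ('a \<Rightarrow> real) \<Rightarrow> real" where
  "avg A h = (\<Sum>a\<in>A. h a) / real (card A)"

end

(*
Everything reduces to a fixed t in [0,1], that is, to a real-valued f. Replace f by its convolution A f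
with the n-fold product of the square of a tent function of width n. Moving a point inside the cube [-n,n]^n
costs n diagonal steps and at most n coordinate steps, and the lower bound on m makes m^(-p) times this
error admissible, so f may be replaced by A f; the translation by 2 m eps_S is then split into m steps.
For A f, the difference A f(x + eps_S) - A f(x - eps_S) is the linear function sum_{j in S} eps_j L_j(x)
of the signs up to an error governed by second differences of the kernel, whose L_1 norm is O(1/n).
The linear case is Rosenthal's inequality with constant O(p / ln p) for the sum over a random k-subset, and
linearizing once more, now with S = {1,...,n}, returns from E |sum_j eps_j L_j|^p to the diagonal differences of f.
*)
theory Submission
  imports Defs "HOL-Library.Function_Algebras"
begin

section \<open>Convexity\<close>

text \<open>Both sides are integrals over t of p-th powers of real differences, so an inequality at
  each t integrates to the L_p statement. The obstacle is the size of the linearization error. The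
  shifts that occur can have about n nonzero entries, and a first difference of the kernel along
  such a shift has L_1 norm of order n^(-1/2). Hoelder's inequality over S costs |S|^(p-1), which a
  factor n^(-p/2) does not absorb when p > 2 and k is comparable to n. Hence the error is
  symmetrized until only second differences remain, where the first-order parts cancel. Width n is
  the right scale for the tent: a unit shift changes one normalized factor by O(1/n) in L_2, and n
  squared changes of that size add up to O(1/n). A wider tent would enlarge the smoothing error, in
  which the side of the cube enters as n^p against m^p. The factor p / ln p has a single origin, the
  exponential moments with parameter ln p. Every other loss has the form c^p: splittings into two or
  three summands, the constant 22 of the kernel estimate, and the bound ln p >= 1/2.\<close>

lemma abs_weighted_sum_powr_le:
  fixes w a :: "'a \<Rightarrow> real" and p C :: real
  assumes A: "finite A" and p: "1 \<le> p" and C: "(\<Sum>i\<in>A. \<bar>w i\<bar>) \<le> C"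
  shows "\<bar>\<Sum>i\<in>A. w i * a i\<bar> powr p \<le> C powr (p - 1) * (\<Sum>i\<in>A. \<bar>w i\<bar> * \<bar>a i\<bar> powr p)"
proof -
  \<comment> \<open>Dropping the vanishing terms leaves positive weights and points of the open
    half-line, where Jensen's inequality for \<open>x powr p\<close> applies with weights |w i| / W;
    in particular W > 0.\<close>
  define B where "B = {i\<in>A. w i \<noteq> 0 \<and> a i \<noteq> 0}"
  define W where "W = (\<Sum>i\<in>B. \<bar>w i\<bar>)"
  have B: "finite B" "B \<subseteq> A" using A by (auto simp: B_def)
  have C0: "0 \<le> C" using C sum_nonneg[of A "\<lambda>i. \<bar>w i\<bar>"] by linarith
  have eqB: "(\<Sum>i\<in>A. w i * a i) = (\<Sum>i\<in>B. w i * a i)"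
    by (rule sum.mono_neutral_right) (use A in \<open>auto simp: B_def\<close>)
  show ?thesis
  proof (cases "B = {}")
    case True
    then show ?thesis using eqB C0 by (auto intro!: mult_nonneg_nonneg sum_nonneg)
  next
    case False
    then have W0: "W > 0" unfolding W_def by (intro sum_pos B) (auto simp: B_def)
    have WC: "W \<le> C" using sum_mono2[OF A B(2), of "\<lambda>i. \<bar>w i\<bar>"] C unfolding W_def by linarith
    have "\<bar>\<Sum>i\<in>B. w i * a i\<bar> \<le> (\<Sum>i\<in>B. \<bar>w i\<bar> * \<bar>a i\<bar>)"
      using sum_abs[of "\<lambda>i. w i * a i" B] by (simp add: abs_mult)
    also have "\<dots> = W * (\<Sum>i\<in>B. (\<bar>w i\<bar> / W) *\<^sub>R \<bar>a i\<bar>)"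
      using W0 by (simp add: sum_distrib_left)
    finally have "\<bar>\<Sum>i\<in>B. w i * a i\<bar> powr p \<le> (W * (\<Sum>i\<in>B. (\<bar>w i\<bar> / W) *\<^sub>R \<bar>a i\<bar>)) powr p"
      by (rule powr_mono2[rotated 2]) (use p in auto)
    also have "\<dots> = W powr p * (\<Sum>i\<in>B. (\<bar>w i\<bar> / W) *\<^sub>R \<bar>a i\<bar>) powr p"
      using W0 by (simp add: powr_mult sum_nonneg)
    also have "(\<Sum>i\<in>B. (\<bar>w i\<bar> / W) *\<^sub>R \<bar>a i\<bar>) powr p \<le> (\<Sum>i\<in>B. (\<bar>w i\<bar> / W) * \<bar>a i\<bar> powr p)"
    proof (rule convex_on_sum[OF B(1) False powr_convex[OF p]])
      show "(\<Sum>i\<in>B. \<bar>w i\<bar> / W) = 1"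
        using W0 by (simp add: sum_divide_distrib[symmetric] W_def)
    qed (use W0 in \<open>auto simp: B_def\<close>)
    also have "W powr p * (\<Sum>i\<in>B. (\<bar>w i\<bar> / W) * \<bar>a i\<bar> powr p) = W powr (p - 1) * (\<Sum>i\<in>B. \<bar>w i\<bar> * \<bar>a i\<bar> powr p)"
      using W0 by (simp add: powr_diff sum_divide_distrib sum_distrib_left field_simps)
    also have "\<dots> \<le> C powr (p - 1) * (\<Sum>i\<in>A. \<bar>w i\<bar> * \<bar>a i\<bar> powr p)"
      by (intro mult_mono powr_mono2 sum_mono2 A B sum_nonneg) (use p W0 WC in auto)
    finally show ?thesis using eqB by (simp add: mult_left_mono)
  qed
qed

lemma abs_sum_powr_le:
  fixes a :: "'a \<Rightarrow> real" and p :: real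
  assumes "finite A" "1 \<le> p" "real (card A) \<le> C"
  shows "\<bar>\<Sum>i\<in>A. a i\<bar> powr p \<le> C powr (p - 1) * (\<Sum>i\<in>A. \<bar>a i\<bar> powr p)"
  using abs_weighted_sum_powr_le[of A p "\<lambda>_. 1" C a] assms by simp

lemma abs_add_powr_le:
  fixes x y p :: real
  assumes "1 \<le> p"
  shows "\<bar>x + y\<bar> powr p \<le> 2 powr (p - 1) * (\<bar>x\<bar> powr p + \<bar>y\<bar> powr p)"
  using abs_sum_powr_le[of "UNIV :: bool set" p 2 "\<lambda>b. if b then x else y"] assms
  by (simp add: UNIV_bool algebra_simps)

lemma abs_add3_powr_le:
  fixes x y z p :: real
  assumes "1 \<le> p"
  shows "\<bar>x + y + z\<bar> powr p \<le> 3 powr (p - 1) * (\<bar>x\<bar> powr p + \<bar>y\<bar> powr p + \<bar>z\<bar> powr p)"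
  using abs_sum_powr_le[of "{0..2::nat}" p 3 "\<lambda>i. if i = 0 then x else if i = 1 then y else z"] assms
  by (simp add: numeral_2_eq_2 algebra_simps)

section \<open>Random subsets of fixed size\<close>

lemma choose_absorb_real:
  assumes "1 \<le> k" "k \<le> n"
  shows "real ((n - 1) choose (k - 1)) = real k / real n * real (n choose k)"
proof -
  obtain k' where k': "k = Suc k'" using assms by (cases k) auto
  have "real (k * (n choose k)) = real (n * ((n - 1) choose (k - 1)))"
    using binomial_absorption[of k' n] k' by simp
  then show ?thesis using assms by (simp add: field_simps)
qed

lemma pred_divide_pred_le:
  assumes "1 \<le> k" "k \<le> n"
  shows "real (k - 1) / real (n - 1) \<le> real k / real n"
proof (cases "n = 1")
  case False
  have "(real k - 1) * real n \<le> real k * (real n - 1)"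
    using assms by (simp add: algebra_simps)
  then show ?thesis
    using False assms by (simp add: of_nat_diff frac_le_eq[symmetric] pos_divide_le_eq pos_le_divide_eq mult.commute)
qed simp

text \<open>The probability that a random k-subset contains t given points is the product of (k - i)
  / (n - i) over i < t, and each factor is at most k / n.\<close>

lemma choose_diff_le:
  assumes "t \<le> k" "k \<le> n"
  shows "real ((n - t) choose (k - t)) \<le> (real k / real n) ^ t * real (n choose k)"
  using assms
proof (induction t arbitrary: n k)
  case (Suc t)
  have k: "1 \<le> k" "1 \<le> n" "t \<le> k - 1" "k - 1 \<le> n - 1" using Suc.prems by auto
  have r: "real (k - 1) / real (n - 1) \<le> real k / real n"
    using pred_divide_pred_le Suc.prems k by simp
  have "real ((n - Suc t) choose (k - Suc t)) = real ((n - 1 - t) choose (k - 1 - t))" by simp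
  also have "\<dots> \<le> (real (k - 1) / real (n - 1)) ^ t * real ((n - 1) choose (k - 1))"
    by (rule Suc.IH) (use k in auto)
  also have "\<dots> = (real (k - 1) / real (n - 1)) ^ t * (real k / real n * real (n choose k))"
    using choose_absorb_real[of k n] k Suc.prems by simp
  also have "\<dots> \<le> (real k / real n) ^ t * (real k / real n * real (n choose k))"
    using r by (intro mult_right_mono power_mono) auto
  finally show ?case by (simp add: algebra_simps)
qed auto

lemma card_supersets:
  assumes "finite A" "T \<subseteq> A" "card T \<le> k"
  shows "card {S. S \<subseteq> A \<and> card S = k \<and> T \<subseteq> S} = (card A - card T) choose (k - card T)"
proof -
  have fin: "finite T" using assms finite_subset by blast
  have "bij_betw (\<lambda>S. S \<union> T) {S. S \<subseteq> A - T \<and> card S = k - card T} {S. S \<subseteq> A \<and> card S = k \<and> T \<subseteq> S}"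
  proof (rule bij_betw_byWitness[where f' = "\<lambda>S. S - T"])
    show "(\<lambda>S. S \<union> T) ` {S. S \<subseteq> A - T \<and> card S = k - card T} \<subseteq> {S. S \<subseteq> A \<and> card S = k \<and> T \<subseteq> S}"
    proof (clarsimp, intro conjI)
      fix S assume S: "S \<subseteq> A - T" "card S = k - card T"
      show "S \<subseteq> A" "T \<subseteq> A" using S assms by auto
      have "finite S" "S \<inter> T = {}" using S assms finite_subset by blast+
      then show "card (S \<union> T) = k" using S assms fin by (simp add: card_Un_disjoint)
    qed
    show "(\<lambda>S. S - T) ` {S. S \<subseteq> A \<and> card S = k \<and> T \<subseteq> S} \<subseteq> {S. S \<subseteq> A - T \<and> card S = k - card T}"
      using fin by (auto simp: card_Diff_subset)
  qed auto
  from bij_betw_same_card[OF this, symmetric]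
  show ?thesis using n_subsets[of "A - T" "k - card T"] assms fin by (simp add: card_Diff_subset)
qed

text \<open>For a uniformly random \<open>k\<close>-subset the events \<open>j \<in> S\<close> are negatively dependent, so the
  expectation of a product is at most the one for independent selectors of mean \<open>k / card A\<close>.\<close>
lemma sum_subsets_prod_le:
  fixes h :: "'a \<Rightarrow> real"
  assumes A: "finite A" and k: "k \<le> card A" and h: "\<And>i. i \<in> A \<Longrightarrow> 0 \<le> h i"
  shows "(\<Sum>S | S \<subseteq> A \<and> card S = k. \<Prod>i\<in>S. 1 + h i)
    \<le> real (card A choose k) * exp (real k / real (card A) * (\<Sum>i\<in>A. h i))"
proof -
  define \<alpha> where "\<alpha> = real k / real (card A)"
  have fS: "finite {S. S \<subseteq> A \<and> card S = k}" using A by simp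
  \<comment> \<open>Expanding the product over subsets T and exchanging the sums leaves only the
    number of S that contain T; since h is nonnegative, the bound may be applied term by
    term.\<close>
  have "(\<Sum>S | S \<subseteq> A \<and> card S = k. \<Prod>i\<in>S. 1 + h i)
      = (\<Sum>S | S \<subseteq> A \<and> card S = k. \<Sum>T\<in>Pow S. \<Prod>i\<in>T. h i)"
  proof (rule sum.cong[OF refl])
    fix S assume "S \<in> {S. S \<subseteq> A \<and> card S = k}"
    then have "finite S" using A finite_subset by auto
    from prod_add[OF this, of h "\<lambda>_. 1"] show "(\<Prod>i\<in>S. 1 + h i) = (\<Sum>T\<in>Pow S. \<Prod>i\<in>T. h i)"
      by (simp add: add.commute)
  qed
  also have "\<dots> = (\<Sum>S | S \<subseteq> A \<and> card S = k. \<Sum>T | T \<in> Pow A \<and> T \<subseteq> S. \<Prod>i\<in>T. h i)"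
    by (intro sum.cong refl) auto
  also have "\<dots> = (\<Sum>T\<in>Pow A. \<Sum>S | S \<in> {S. S \<subseteq> A \<and> card S = k} \<and> T \<subseteq> S. \<Prod>i\<in>T. h i)"
    by (rule sum.swap_restrict) (use A in auto)
  also have "\<dots> \<le> (\<Sum>T\<in>Pow A. real (card A choose k) * (\<Prod>i\<in>T. \<alpha> * h i))"
  proof (rule sum_mono)
    fix T assume T: "T \<in> Pow A"
    have fT: "finite T" using T A finite_subset by blast
    have h0: "0 \<le> (\<Prod>i\<in>T. h i)" using T h by (auto intro!: prod_nonneg)
    have "real (card {S. S \<subseteq> A \<and> card S = k \<and> T \<subseteq> S}) \<le> \<alpha> ^ card T * real (card A choose k)"
    proof (cases "card T \<le> k")
      case True
      then show ?thesis using card_supersets[OF A _ True] T choose_diff_le[OF True k]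
        by (simp add: \<alpha>_def)
    next
      case False
      have "{S. S \<subseteq> A \<and> card S = k \<and> T \<subseteq> S} = {}"
        using False A by (auto dest: finite_subset card_mono[rotated])
      then show ?thesis by (simp only:) (simp add: \<alpha>_def)
    qed
    from mult_right_mono[OF this h0]
    show "(\<Sum>S | S \<in> {S. S \<subseteq> A \<and> card S = k} \<and> T \<subseteq> S. \<Prod>i\<in>T. h i) \<le> real (card A choose k) * (\<Prod>i\<in>T. \<alpha> * h i)"
      by (simp add: prod.distrib conj_assoc algebra_simps)
  qed
  also have "\<dots> = real (card A choose k) * (\<Prod>i\<in>A. 1 + \<alpha> * h i)"
    using prod_add[OF A, of "\<lambda>i. \<alpha> * h i" "\<lambda>_. 1"] by (simp add: add.commute sum_distrib_left)
  also have "(\<Prod>i\<in>A. 1 + \<alpha> * h i) \<le> (\<Prod>i\<in>A. exp (\<alpha> * h i))"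
    by (intro prod_mono) (use h in \<open>auto simp: \<alpha>_def exp_ge_add_one_self intro!: add_nonneg_nonneg mult_nonneg_nonneg\<close>)
  also have "\<dots> = exp (\<alpha> * (\<Sum>i\<in>A. h i))"
    using A by (simp add: exp_sum sum_distrib_left)
  finally show ?thesis by (simp add: \<alpha>_def mult_left_mono)
qed

lemma sum_subsets_sum:
  fixes a :: "'a \<Rightarrow> real"
  assumes A: "finite A" and k: "1 \<le> k" "k \<le> card A"
  shows "(\<Sum>S | S \<subseteq> A \<and> card S = k. \<Sum>i\<in>S. a i)
    = real (card A choose k) * (real k / real (card A)) * (\<Sum>i\<in>A. a i)"
proof -
  have "(\<Sum>S | S \<subseteq> A \<and> card S = k. \<Sum>i\<in>S. a i) = (\<Sum>S | S \<subseteq> A \<and> card S = k. \<Sum>i | i \<in> A \<and> i \<in> S. a i)"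
    by (intro sum.cong refl) auto
  also have "\<dots> = (\<Sum>i\<in>A. \<Sum>S | S \<in> {S. S \<subseteq> A \<and> card S = k} \<and> i \<in> S. a i)"
    by (rule sum.swap_restrict) (use A in auto)
  also have "\<dots> = (\<Sum>i\<in>A. real ((card A - 1) choose (k - 1)) * a i)"
  proof (rule sum.cong[OF refl])
    fix i assume "i \<in> A"
    then show "(\<Sum>S | S \<in> {S. S \<subseteq> A \<and> card S = k} \<and> i \<in> S. a i) = real ((card A - 1) choose (k - 1)) * a i"
      using card_supersets[OF A, of "{i}" k] k by (simp add: conj_assoc)
  qed
  also have "\<dots> = real ((card A - 1) choose (k - 1)) * (\<Sum>i\<in>A. a i)"
    by (simp add: sum_distrib_left)
  finally show ?thesis
    using choose_absorb_real[OF k] by (simp add: mult.commute)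
qed

text \<open>Given that j lies in S, the rest of S is a uniform (k - 1)-subset of A - {j}, whose
  density (k - 1) / (|A| - 1) is at most k / |A|. So conditioning on j costs only the factor 1 + h
  j.\<close>

lemma sum_subsets_mem_prod_le:
  fixes h :: "'a \<Rightarrow> real"
  assumes A: "finite A" and k: "1 \<le> k" "k \<le> card A" and h: "\<And>i. i \<in> A \<Longrightarrow> 0 \<le> h i" and j: "j \<in> A"
  shows "(\<Sum>S | S \<subseteq> A \<and> card S = k \<and> j \<in> S. \<Prod>i\<in>S. 1 + h i)
    \<le> real (card A choose k) * (real k / real (card A)) * (1 + h j)
        * exp (real k / real (card A) * (\<Sum>i\<in>A. h i))"
proof -
  have fin: "finite S" if "S \<subseteq> A" for S using A that finite_subset by auto
  have c: "card (A - {j}) = card A - 1" using A j by simp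
  have r: "real (k - 1) / real (card A - 1) \<le> real k / real (card A)"
    using pred_divide_pred_le k by simp
  have "(\<Sum>S | S \<subseteq> A \<and> card S = k \<and> j \<in> S. \<Prod>i\<in>S. 1 + h i)
      = (\<Sum>S | S \<subseteq> A - {j} \<and> card S = k - 1. (1 + h j) * (\<Prod>i\<in>S. 1 + h i))"
  proof (rule sum.reindex_bij_witness[where j = "\<lambda>S. S - {j}" and i = "insert j"])
    fix S assume "S \<in> {S. S \<subseteq> A \<and> card S = k \<and> j \<in> S}"
    then show "insert j (S - {j}) = S" "S - {j} \<in> {S. S \<subseteq> A - {j} \<and> card S = k - 1}"
      "(1 + h j) * (\<Prod>i\<in>S - {j}. 1 + h i) = (\<Prod>i\<in>S. 1 + h i)"
      using fin by (auto simp: prod.remove)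
  next
    fix S assume S: "S \<in> {S. S \<subseteq> A - {j} \<and> card S = k - 1}"
    then have "finite S" using fin by auto
    with S show "insert j S - {j} = S" "insert j S \<in> {S. S \<subseteq> A \<and> card S = k \<and> j \<in> S}"
      using j k by (auto simp: card_insert_if)
  qed
  also have "\<dots> = (1 + h j) * (\<Sum>S | S \<subseteq> A - {j} \<and> card S = k - 1. \<Prod>i\<in>S. 1 + h i)"
    by (simp add: sum_distrib_left)
  also have "\<dots> \<le> (1 + h j) * (real ((card A - 1) choose (k - 1))
      * exp (real (k - 1) / real (card A - 1) * (\<Sum>i\<in>A - {j}. h i)))"
    using sum_subsets_prod_le[of "A - {j}" "k - 1" h] A h[OF j] h k c
    by (intro mult_left_mono) auto
  also have "\<dots> \<le> (1 + h j) * (real ((card A - 1) choose (k - 1)) * exp (real k / real (card A) * (\<Sum>i\<in>A. h i)))"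
  proof -
    have "real (k - 1) / real (card A - 1) * (\<Sum>i\<in>A - {j}. h i) \<le> real k / real (card A) * (\<Sum>i\<in>A. h i)"
      by (rule mult_mono[OF r sum_mono2]) (use A h in \<open>auto intro!: sum_nonneg\<close>)
    then show ?thesis using h[OF j] by (intro mult_left_mono) auto
  qed
  finally show ?thesis
    unfolding choose_absorb_real[OF k] by (simp only: mult_ac)
qed

section \<open>Rosenthal's inequality for random subsets\<close>

lemma finite_signs [simp]: "finite (signs n)"
  unfolding signs_def by (intro finite_PiE) auto

lemma card_signs [simp]: "card (signs n) = 2 ^ n"
  unfolding signs_def by (simp add: card_PiE numeral_2_eq_2)

lemma sum_signs_prod:
  fixes \<phi> :: "nat \<Rightarrow> int \<Rightarrow> real"
  shows "(\<Sum>eps\<in>signs n. \<Prod>i<n. \<phi> i (eps i)) = (\<Prod>i<n. \<phi> i (-1) + \<phi> i 1)"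
  unfolding signs_def by (subst prod_sum_PiE[symmetric]) auto

lemma sum_signs_exp:
  fixes v :: "nat \<Rightarrow> real" and t :: real
  assumes S: "S \<subseteq> {..<n}"
  shows "(\<Sum>eps\<in>signs n. exp (t * (\<Sum>j\<in>S. of_int (eps j) * v j))) = 2 ^ n * (\<Prod>j\<in>S. cosh (t * v j))"
proof -
  have fin: "finite S" using S finite_subset by blast
  have restr: "(\<Prod>i<n. if i \<in> S then F i else 1) = (\<Prod>i\<in>S. F i)" for F :: "nat \<Rightarrow> real"
    using S by (simp add: prod.If_cases Int_absorb1)
  have "(\<Sum>eps\<in>signs n. exp (t * (\<Sum>j\<in>S. of_int (eps j) * v j)))
      = (\<Sum>eps\<in>signs n. \<Prod>i<n. if i \<in> S then exp (t * (of_int (eps i) * v i)) else 1)"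
    using fin by (simp add: restr sum_distrib_left exp_sum)
  also have "\<dots> = (\<Prod>i<n. 2 * (if i \<in> S then cosh (t * v i) else 1))"
    by (subst sum_signs_prod[where \<phi> = "\<lambda>i s. if i \<in> S then exp (t * (of_int s * v i)) else 1"])
       (auto intro!: prod.cong simp: cosh_def)
  also have "\<dots> = 2 ^ n * (\<Prod>j\<in>S. cosh (t * v j))"
    by (simp only: prod.distrib restr) simp
  finally show ?thesis .
qed

text \<open>Compare the power series: beyond the constant term only even powers v^(2 l) with l >= 1
  occur, and these are at most v^2. This makes exponential moments of bounded coefficients depend on
  the variance alone.\<close>

lemma cosh_mult_le:
  fixes t v :: real
  assumes v: "\<bar>v\<bar> \<le> 1"
  shows "cosh (t * v) - 1 \<le> v\<^sup>2 * (cosh t - 1)"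
proof -
  have v2: "v\<^sup>2 \<le> 1" using v by (simp add: abs_square_le_1)
  have "(\<lambda>n. v\<^sup>2 * (if even n then t ^ n /\<^sub>R fact n else 0) + (if n = 0 then 1 - v\<^sup>2 else 0))
      sums (v\<^sup>2 * cosh t + (1 - v\<^sup>2))"
    using sums_single[of 0 "\<lambda>_. 1 - v\<^sup>2"] by (intro sums_add sums_mult cosh_converges) simp
  with cosh_converges[of "t * v"] have "cosh (t * v) \<le> v\<^sup>2 * cosh t + (1 - v\<^sup>2)"
  proof (rule sums_le[rotated])
    fix n :: nat
    show "(if even n then (t * v) ^ n /\<^sub>R fact n else 0)
        \<le> v\<^sup>2 * (if even n then t ^ n /\<^sub>R fact n else 0) + (if n = 0 then 1 - v\<^sup>2 else 0)"
    proof (cases "even n \<and> n \<noteq> 0")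
      case True
      then obtain l where l: "n = 2 * l" "l \<noteq> 0" by (auto elim!: evenE)
      then obtain l' where l': "l = Suc l'" by (cases l) auto
      have "(v\<^sup>2) ^ l \<le> v\<^sup>2" using power_le_one[of "v\<^sup>2" l'] v2 l'
        by (simp add: mult_left_le)
      then have "v ^ n \<le> v\<^sup>2" using l by (simp add: power_mult)
      moreover have "0 \<le> t ^ n" using True by (simp add: zero_le_even_power)
      ultimately have "t ^ n * v ^ n \<le> t ^ n * v\<^sup>2" by (rule mult_left_mono)
      then show ?thesis using True
        by (simp add: power_mult_distrib divide_right_mono field_simps)
    qed auto
  qed
  then show ?thesis by (simp add: algebra_simps)
qed

text \<open>The function x^p exp (- t x) is largest at x = p / t; equivalently y <= exp (y - 1),
  raised to the power p, with y = t x / p.\<close>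

lemma powr_le_exp:
  fixes x p t :: real
  assumes "0 \<le> x" "0 < p" "0 < t"
  shows "x powr p \<le> (p / t) powr p * exp (t * x - p)"
proof -
  define y where "y = t * x / p"
  have y: "0 \<le> y" "x = (p / t) * y" using assms by (auto simp: y_def)
  have "y \<le> exp (y - 1)" using exp_ge_add_one_self[of "y - 1"] by simp
  then have "y powr p \<le> exp (y - 1) powr p" using y assms by (intro powr_mono2) auto
  also have "\<dots> = exp (t * x - p)" using assms by (simp add: powr_def y_def field_simps)
  finally have "(p / t) powr p * y powr p \<le> (p / t) powr p * exp (t * x - p)"
    by (intro mult_left_mono) auto
  moreover have "x powr p = (p / t) powr p * y powr p"
    unfolding y(2) by (rule powr_mult)
  ultimately show ?thesis by simp
qed

text \<open>Bennett's method: |x|^p is dominated by a multiple of exp (t x) + exp (- t x), averaging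
  over signs produces factors cosh, and \<open>cosh_mult_le\<close> reduces them to the variance.
  The parameter t stays free until it is balanced against p.\<close>

lemma Bennett_subset_moment:
  fixes u :: "nat \<Rightarrow> real"
  assumes k: "k \<le> n" and p: "0 < p" and t: "0 < t"
    and u: "\<And>j. j < n \<Longrightarrow> \<bar>u j\<bar> \<le> 1" and var: "real k / real n * (\<Sum>j<n. (u j)\<^sup>2) \<le> 1"
  shows "(\<Sum>S | S \<subseteq> {..<n} \<and> card S = k. \<Sum>eps\<in>signs n. \<bar>\<Sum>j\<in>S. of_int (eps j) * u j\<bar> powr p)
    \<le> real (n choose k) * 2 ^ n * (2 * (p / t) powr p * exp (cosh t - 1 - p))"
proof -
  define c where "c = (p / t) powr p * exp (- p)"
  have c: "0 \<le> c" by (simp add: c_def)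
  have pt: "\<bar>x\<bar> powr p \<le> c * (exp (t * x) + exp ((- t) * x))" for x
  proof -
    have "\<bar>x\<bar> powr p \<le> c * exp (t * \<bar>x\<bar>)"
      using powr_le_exp[of "\<bar>x\<bar>" p t] p t by (simp add: c_def exp_diff exp_minus field_simps)
    also have "exp (t * \<bar>x\<bar>) \<le> exp (t * x) + exp ((- t) * x)" by (simp add: abs_if)
    finally show ?thesis using c by (simp add: mult_left_mono)
  qed
  have "(\<Sum>eps\<in>signs n. \<bar>\<Sum>j\<in>S. of_int (eps j) * u j\<bar> powr p) \<le> 2 ^ n * (2 * c * (\<Prod>j\<in>S. 1 + (cosh (t * u j) - 1)))"
    if S: "S \<subseteq> {..<n}" for S
  proof -
    have "(\<Sum>eps\<in>signs n. \<bar>\<Sum>j\<in>S. of_int (eps j) * u j\<bar> powr p)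
       \<le> (\<Sum>eps\<in>signs n. c * (exp (t * (\<Sum>j\<in>S. of_int (eps j) * u j)) + exp ((- t) * (\<Sum>j\<in>S. of_int (eps j) * u j))))"
      by (intro sum_mono pt)
    also have "\<dots> = c * (2 ^ n * (\<Prod>j\<in>S. cosh (t * u j)) + 2 ^ n * (\<Prod>j\<in>S. cosh ((- t) * u j)))"
      by (simp only: sum_distrib_left[symmetric] sum.distrib sum_signs_exp[OF S])
    finally show ?thesis by (simp add: algebra_simps)
  qed
  then have "(\<Sum>S | S \<subseteq> {..<n} \<and> card S = k. \<Sum>eps\<in>signs n. \<bar>\<Sum>j\<in>S. of_int (eps j) * u j\<bar> powr p)
     \<le> (\<Sum>S | S \<subseteq> {..<n} \<and> card S = k. 2 ^ n * (2 * c * (\<Prod>j\<in>S. 1 + (cosh (t * u j) - 1))))"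
    by (intro sum_mono) simp
  also have "\<dots> = 2 ^ n * (2 * c) * (\<Sum>S | S \<subseteq> {..<n} \<and> card S = k. \<Prod>j\<in>S. 1 + (cosh (t * u j) - 1))"
    by (simp add: sum_distrib_left mult.assoc)
  also have "\<dots> \<le> 2 ^ n * (2 * c) * (real (n choose k) * exp (real k / real n * (\<Sum>j<n. cosh (t * u j) - 1)))"
    using sum_subsets_prod_le[of "{..<n}" k "\<lambda>j. cosh (t * u j) - 1"] k c cosh_real_ge_1
    by (intro mult_left_mono) auto
  also have "\<dots> \<le> 2 ^ n * (2 * c) * (real (n choose k) * exp (cosh t - 1))"
  proof -
    have "real k / real n * (\<Sum>j<n. cosh (t * u j) - 1) \<le> real k / real n * (\<Sum>j<n. (u j)\<^sup>2 * (cosh t - 1))"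
      by (intro mult_left_mono sum_mono cosh_mult_le u) auto
    also have "\<dots> = (real k / real n * (\<Sum>j<n. (u j)\<^sup>2)) * (cosh t - 1)"
      by (simp add: sum_distrib_right)
    also have "\<dots> \<le> cosh t - 1" using mult_right_mono[OF var, of "cosh t - 1"] cosh_real_ge_1[of t] by simp
    finally show ?thesis using c by (intro mult_left_mono) auto
  qed
  also have "\<dots> = real (n choose k) * 2 ^ n * (2 * (p / t) powr p * exp (cosh t - 1 - p))"
    by (simp add: c_def exp_add[symmetric])
  finally show ?thesis .
qed

text \<open>Large coefficients are few: since |w j|^p >= 1 on their set L, the moment bound gives (k
  / n) |L| <= 1. So the signs can be discarded: Hoelder's inequality leaves N^(p-1) with N = |S
  \<inter> L|, and this is absorbed by exp (t N), which is the product of 1 + h over S.\<close>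

lemma large_coefficients_subset_moment:
  fixes w :: "nat \<Rightarrow> real"
  assumes k: "1 \<le> k" "k \<le> n" and p: "1 < p" and t: "0 < t"
    and w: "\<And>j. j < n \<Longrightarrow> w j = 0 \<or> 1 < \<bar>w j\<bar>" and mom: "real k / real n * (\<Sum>j<n. \<bar>w j\<bar> powr p) \<le> 1"
  shows "(\<Sum>S | S \<subseteq> {..<n} \<and> card S = k. \<Sum>eps\<in>signs n. \<bar>\<Sum>j\<in>S. of_int (eps j) * w j\<bar> powr p)
    \<le> real (n choose k) * 2 ^ n * ((p / t) powr p * exp (t + exp t - 1 - p))"
proof -
  define L where "L = {j\<in>{..<n}. w j \<noteq> 0}"
  define h where "h = (\<lambda>j. if j \<in> L then exp t - 1 else 0)"
  define c where "c = (p / t) powr p * exp (- p)"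
  have c: "0 \<le> c" by (simp add: c_def)
  have h0: "0 \<le> h j" for j using t by (simp add: h_def)
  have "\<bar>\<Sum>j\<in>S. of_int (eps j) * w j\<bar> powr p \<le> c * (\<Sum>j\<in>S. \<bar>w j\<bar> powr p * (\<Prod>i\<in>S. 1 + h i))"
    if S: "S \<subseteq> {..<n}" and eps: "eps \<in> signs n" for S eps
  proof -
    have fin: "finite S" using S finite_subset by blast
    define N where "N = real (card (S \<inter> L))"
    have "(\<Sum>j\<in>S. of_int (eps j) * w j) = (\<Sum>j\<in>S \<inter> L. of_int (eps j) * w j)"
      using S fin by (intro sum.mono_neutral_right) (auto simp: L_def)
    then have "\<bar>\<Sum>j\<in>S. of_int (eps j) * w j\<bar> powr p \<le> N powr (p - 1) * (\<Sum>j\<in>S \<inter> L. \<bar>of_int (eps j) * w j\<bar> powr p)"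
      using abs_sum_powr_le[of "S \<inter> L" p N] fin p by (simp add: N_def)
    also have "(\<Sum>j\<in>S \<inter> L. \<bar>of_int (eps j) * w j\<bar> powr p) = (\<Sum>j\<in>S \<inter> L. \<bar>w j\<bar> powr p)"
    proof (rule sum.cong[OF refl])
      fix j assume "j \<in> S \<inter> L"
      then have "eps j \<in> {-1, 1}" using eps S by (auto simp: signs_def PiE_iff)
      then show "\<bar>of_int (eps j) * w j\<bar> powr p = \<bar>w j\<bar> powr p" by auto
    qed
    also have "\<dots> = (\<Sum>j\<in>S. \<bar>w j\<bar> powr p)"
      using S fin by (intro sum.mono_neutral_left) (auto simp: L_def)
    also have "N powr (p - 1) \<le> c * (\<Prod>i\<in>S. 1 + h i)"
    proof -
      \<comment> \<open>N is a natural number: either N >= 1, or both sides are 0 because 0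
        \<open>powr\<close> anything is 0.\<close>
      have "N powr (p - 1) \<le> N powr p"
      proof (cases "card (S \<inter> L) = 0")
        case False
        then have "1 \<le> N" by (simp add: N_def)
        then show ?thesis by (intro powr_mono) auto
      qed (simp add: N_def)
      also have "\<dots> \<le> c * exp (t * N)"
        using powr_le_exp[of N p t] p t by (simp add: N_def c_def exp_diff exp_minus field_simps)
      also have "exp (t * N) = (\<Prod>i\<in>S \<inter> L. exp t)"
        by (simp add: N_def exp_of_nat_mult[symmetric] mult.commute)
      also have "\<dots> = (\<Prod>i\<in>S. 1 + h i)"
        using fin by (intro prod.mono_neutral_cong_left) (auto simp: h_def)
      finally show ?thesis .
    qed
    finally have "\<bar>\<Sum>j\<in>S. of_int (eps j) * w j\<bar> powr p \<le> c * (\<Prod>i\<in>S. 1 + h i) * (\<Sum>j\<in>S. \<bar>w j\<bar> powr p)"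
      by (simp add: mult_right_mono sum_nonneg)
    then show ?thesis by (simp add: sum_distrib_left mult_ac)
  qed
  then have "(\<Sum>S | S \<subseteq> {..<n} \<and> card S = k. \<Sum>eps\<in>signs n. \<bar>\<Sum>j\<in>S. of_int (eps j) * w j\<bar> powr p)
     \<le> (\<Sum>S | S \<subseteq> {..<n} \<and> card S = k. \<Sum>eps\<in>signs n. c * (\<Sum>j\<in>S. \<bar>w j\<bar> powr p * (\<Prod>i\<in>S. 1 + h i)))"
    by (intro sum_mono) simp
  also have "\<dots> = 2 ^ n * c * (\<Sum>S | S \<subseteq> {..<n} \<and> card S = k. \<Sum>j | j \<in> {..<n} \<and> j \<in> S. \<bar>w j\<bar> powr p * (\<Prod>i\<in>S. 1 + h i))"
    by (simp add: sum_distrib_left[symmetric] mult.assoc) (intro sum.cong refl disjI2, auto)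
  also have "(\<Sum>S | S \<subseteq> {..<n} \<and> card S = k. \<Sum>j | j \<in> {..<n} \<and> j \<in> S. \<bar>w j\<bar> powr p * (\<Prod>i\<in>S. 1 + h i))
      = (\<Sum>j\<in>{..<n}. \<Sum>S | S \<in> {S. S \<subseteq> {..<n} \<and> card S = k} \<and> j \<in> S. \<bar>w j\<bar> powr p * (\<Prod>i\<in>S. 1 + h i))"
    by (rule sum.swap_restrict) auto
  also have "\<dots> = (\<Sum>j<n. \<bar>w j\<bar> powr p * (\<Sum>S | S \<subseteq> {..<n} \<and> card S = k \<and> j \<in> S. \<Prod>i\<in>S. 1 + h i))"
    by (simp add: sum_distrib_left conj_assoc)
  also have "\<dots> \<le> (\<Sum>j<n. \<bar>w j\<bar> powr p * (real (n choose k) * (real k / real n) * exp t * exp (exp t - 1)))"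
  proof (rule sum_mono)
    fix j assume j: "j \<in> {..<n}"
    have "real k / real n * (\<Sum>i<n. h i) = (exp t - 1) * (real k / real n * (\<Sum>j\<in>L. 1))"
      by (simp add: h_def L_def sum.If_cases Int_def)
    also have "\<dots> \<le> (exp t - 1) * (real k / real n * (\<Sum>j\<in>L. \<bar>w j\<bar> powr p))"
      using t p w by (intro mult_left_mono sum_mono ge_one_powr_ge_zero) (force simp: L_def)+
    also have "(\<Sum>j\<in>L. \<bar>w j\<bar> powr p) = (\<Sum>j<n. \<bar>w j\<bar> powr p)"
      by (rule sum.mono_neutral_left) (auto simp: L_def)
    also have "(exp t - 1) * (real k / real n * (\<Sum>j<n. \<bar>w j\<bar> powr p)) \<le> exp t - 1"
      using mult_left_mono[OF mom, of "exp t - 1"] t by simp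
    finally have E: "real k / real n * (\<Sum>i<n. h i) \<le> exp t - 1" .
    have hj: "1 + h j \<le> exp t" using t by (simp add: h_def)
    have "(\<Sum>S | S \<subseteq> {..<n} \<and> card S = k \<and> j \<in> S. \<Prod>i\<in>S. 1 + h i)
       \<le> real (n choose k) * (real k / real n) * (1 + h j) * exp (real k / real n * (\<Sum>i<n. h i))"
      using sum_subsets_mem_prod_le[of "{..<n}" k h j] k h0 j by simp
    also have "\<dots> \<le> real (n choose k) * (real k / real n) * exp t * exp (exp t - 1)"
      by (intro mult_mono hj) (use E h0[of j] in \<open>auto intro!: mult_nonneg_nonneg\<close>)
    finally show "\<bar>w j\<bar> powr p * (\<Sum>S | S \<subseteq> {..<n} \<and> card S = k \<and> j \<in> S. \<Prod>i\<in>S. 1 + h i)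
      \<le> \<bar>w j\<bar> powr p * (real (n choose k) * (real k / real n) * exp t * exp (exp t - 1))"
      by (intro mult_left_mono) auto
  qed
  also have "\<dots> = real (n choose k) * exp t * exp (exp t - 1) * (real k / real n * (\<Sum>j<n. \<bar>w j\<bar> powr p))"
    unfolding sum_distrib_right[symmetric] by (simp only: mult_ac)
  also have "\<dots> \<le> real (n choose k) * exp t * exp (exp t - 1) * 1"
    by (intro mult_left_mono mom) auto
  finally have "(\<Sum>S | S \<subseteq> {..<n} \<and> card S = k. \<Sum>eps\<in>signs n. \<bar>\<Sum>j\<in>S. of_int (eps j) * w j\<bar> powr p)
     \<le> 2 ^ n * c * (real (n choose k) * exp t * exp (exp t - 1) * 1)"
    using c by (simp add: mult_left_mono)
  also have "\<dots> = real (n choose k) * 2 ^ n * ((p / t) powr p * exp (t + exp t - 1 - p))"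
    by (simp add: c_def exp_add exp_diff exp_minus field_simps)
  finally show ?thesis .
qed

lemma two_le_two_powr:
  fixes p :: real
  assumes "1 \<le> p" shows "2 \<le> (2::real) powr p"
  using powr_mono[OF assms, of 2] by simp

lemma le_two_powr:
  fixes p :: real
  assumes "2 \<le> p" shows "p \<le> 2 powr p"
proof -
  have l: "ln 2 \<ge> (1/2::real)" using ln_le_minus_one[of "1/2::real"] by (simp add: ln_div)
  have "p / 2 \<le> exp (p / 2 - 1)" using exp_ge_add_one_self[of "p / 2 - 1"] by simp
  also have "\<dots> \<le> exp (p * ln 2 - ln 2)"
  proof -
    have "(p - 1) * (1/2) \<le> (p - 1) * ln 2" using l assms by (intro mult_left_mono) auto
    then have "p / 2 - 1 \<le> p * ln 2 - ln 2" by (simp add: algebra_simps diff_divide_distrib)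
    then show ?thesis by simp
  qed
  also have "\<dots> = 2 powr p / 2" by (simp add: powr_def exp_diff)
  finally show ?thesis by simp
qed

text \<open>The parameter \<open>t = ln p\<close> of the exponential moments balances \<open>exp t\<close> against \<open>p\<close>; it is what produces
  \<open>p / ln p\<close> instead of \<open>p\<close>.\<close>
lemma Rosenthal_subset_normalized:
  fixes u :: "nat \<Rightarrow> real"
  assumes k: "1 \<le> k" "k \<le> n" and p: "2 \<le> p"
    and var: "real k / real n * (\<Sum>j<n. (u j)\<^sup>2) \<le> 1"
    and mom: "real k / real n * (\<Sum>j<n. \<bar>u j\<bar> powr p) \<le> 1"
  shows "(\<Sum>S | S \<subseteq> {..<n} \<and> card S = k. \<Sum>eps\<in>signs n. \<bar>\<Sum>j\<in>S. of_int (eps j) * u j\<bar> powr p)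
    \<le> real (n choose k) * 2 ^ n * (4 * (p / ln p)) powr p"
proof -
  \<comment> \<open>Truncation at level 1, the scale fixed by the normalization: the small
    coefficients are controlled by the variance, the large ones by the p-th moment.\<close>
  define a where "a = (\<lambda>j. if \<bar>u j\<bar> \<le> 1 then u j else 0)"
  define b where "b = (\<lambda>j. if \<bar>u j\<bar> \<le> 1 then 0 else u j)"
  have t: "0 < ln p" using p by simp
  have et: "exp (ln p) = p" using p by simp
  have "cosh (ln p) \<le> p + 1"
    using p le_imp_inverse_le[of 1 p] by (simp add: cosh_ln_real)
  then have e1: "exp (cosh (ln p) - 1 - p) \<le> 1" by simp
  \<comment> \<open>With t = ln p the exponential becomes p / e, so it costs no more than
    2^p.\<close>
  have e2: "exp (ln p + exp (ln p) - 1 - p) \<le> 2 powr p"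
  proof -
    have "exp (ln p + exp (ln p) - 1 - p) = p * exp (- 1)" using p by (simp add: exp_diff exp_minus divide_simps)
    also have "\<dots> \<le> p * 1" using p by (intro mult_left_mono) auto
    also have "\<dots> \<le> 2 powr p" using le_two_powr[OF p] by simp
    finally show ?thesis .
  qed
  have "real k / real n * (\<Sum>j<n. (a j)\<^sup>2) \<le> real k / real n * (\<Sum>j<n. (u j)\<^sup>2)"
    by (intro mult_left_mono sum_mono) (auto simp: a_def)
  then have vara: "real k / real n * (\<Sum>j<n. (a j)\<^sup>2) \<le> 1" using var by linarith
  have "real k / real n * (\<Sum>j<n. \<bar>b j\<bar> powr p) \<le> real k / real n * (\<Sum>j<n. \<bar>u j\<bar> powr p)"
    by (intro mult_left_mono sum_mono) (auto simp: b_def)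
  then have momb: "real k / real n * (\<Sum>j<n. \<bar>b j\<bar> powr p) \<le> 1" using mom by linarith
  have split: "\<bar>\<Sum>j\<in>S. of_int (eps j) * u j\<bar> powr p
     \<le> 2 powr (p - 1) * (\<bar>\<Sum>j\<in>S. of_int (eps j) * a j\<bar> powr p + \<bar>\<Sum>j\<in>S. of_int (eps j) * b j\<bar> powr p)" for S and eps :: "nat \<Rightarrow> int"
  proof -
    have "(\<Sum>j\<in>S. of_int (eps j) * u j) = (\<Sum>j\<in>S. of_int (eps j) * a j) + (\<Sum>j\<in>S. of_int (eps j) * b j)"
      unfolding sum.distrib[symmetric] by (intro sum.cong refl) (auto simp: a_def b_def)
    then show ?thesis using abs_add_powr_le[of p] p by simp
  qed
  let ?C = "real (n choose k) * 2 ^ n" and ?q = "(p / ln p) powr p"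
  have "(\<Sum>S | S \<subseteq> {..<n} \<and> card S = k. \<Sum>eps\<in>signs n. \<bar>\<Sum>j\<in>S. of_int (eps j) * u j\<bar> powr p)
     \<le> (\<Sum>S | S \<subseteq> {..<n} \<and> card S = k. \<Sum>eps\<in>signs n. 2 powr (p - 1) * (\<bar>\<Sum>j\<in>S. of_int (eps j) * a j\<bar> powr p + \<bar>\<Sum>j\<in>S. of_int (eps j) * b j\<bar> powr p))"
    by (intro sum_mono split)
  also have "\<dots> = 2 powr (p - 1) *
      ((\<Sum>S | S \<subseteq> {..<n} \<and> card S = k. \<Sum>eps\<in>signs n. \<bar>\<Sum>j\<in>S. of_int (eps j) * a j\<bar> powr p)
      + (\<Sum>S | S \<subseteq> {..<n} \<and> card S = k. \<Sum>eps\<in>signs n. \<bar>\<Sum>j\<in>S. of_int (eps j) * b j\<bar> powr p))"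
    by (simp only: sum_distrib_left[symmetric] sum.distrib)
  also have "\<dots> \<le> 2 powr (p - 1) * (?C * (2 * ?q * exp (cosh (ln p) - 1 - p)) + ?C * (?q * exp (ln p + exp (ln p) - 1 - p)))"
    using Bennett_subset_moment[OF k(2) _ t _ vara, of p] large_coefficients_subset_moment[OF k _ t _ momb] p
    by (intro mult_left_mono add_mono) (auto simp: a_def b_def)
  also have "\<dots> \<le> 2 powr (p - 1) * (?C * (2 * ?q * 1) + ?C * (?q * 2 powr p))"
    using e1 e2 by (intro mult_left_mono add_mono) auto
  also have "\<dots> \<le> 2 powr (p - 1) * (?C * (2 powr p * ?q) + ?C * (?q * 2 powr p))"
    using two_le_two_powr[of p] p by (intro mult_left_mono add_mono) (auto intro!: mult_right_mono)
  also have "\<dots> = ?C * ((2 powr p * 2 powr p) * ?q)"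
    by (simp add: powr_diff algebra_simps)
  also have "\<dots> = ?C * (4 * (p / ln p)) powr p"
    by (simp add: powr_mult[symmetric])
  finally show ?thesis .
qed

text \<open>Homogeneity: dividing v by l, where l^p is the sum of the moment term and the variance
  term, makes both normalized hypotheses true at once. If that sum is 0, all coefficients
  vanish.\<close>

lemma Rosenthal_subset:
  fixes v :: "nat \<Rightarrow> real"
  assumes k: "1 \<le> k" "k \<le> n" and p: "2 \<le> p"
  shows "(\<Sum>S | S \<subseteq> {..<n} \<and> card S = k. \<Sum>eps\<in>signs n. \<bar>\<Sum>j\<in>S. of_int (eps j) * v j\<bar> powr p)
    \<le> real (n choose k) * 2 ^ n * (4 * (p / ln p)) powr p
      * (real k / real n * (\<Sum>j<n. \<bar>v j\<bar> powr p) + (real k / real n) powr (p / 2) * (\<Sum>j<n. (v j)\<^sup>2) powr (p / 2))"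
    (is "?lhs \<le> ?C * (?X + ?Y)")
proof -
  have X0: "0 \<le> ?X" by (intro mult_nonneg_nonneg sum_nonneg) auto
  have Y0: "0 \<le> ?Y" by simp
  show ?thesis
  proof (cases "?X + ?Y = 0")
    case True
    then have "?X = 0" using X0 Y0 by linarith
    then have "(\<Sum>j<n. \<bar>v j\<bar> powr p) = 0" using k by simp
    then have v: "v j = 0" if "j < n" for j using that by (subst (asm) sum_nonneg_eq_0_iff) auto
    have "?lhs = 0"
      by (intro sum.neutral ballI) (use v in \<open>auto intro!: sum.neutral\<close>)
    then show ?thesis using X0 Y0 by simp
  next
    case False
    define l where "l = (?X + ?Y) powr (1 / p)"
    have l0: "0 < l" using False by (simp add: l_def)
    have lp: "l powr p = ?X + ?Y" using X0 Y0 p by (simp add: l_def powr_powr)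
    define u where "u = (\<lambda>j. v j / l)"
    have vu: "v j = l * u j" for j using l0 by (simp add: u_def)
    have mom: "real k / real n * (\<Sum>j<n. \<bar>u j\<bar> powr p) \<le> 1"
    proof -
      have "real k / real n * (\<Sum>j<n. \<bar>u j\<bar> powr p) = ?X / l powr p"
        using l0 by (simp add: u_def powr_divide flip: sum_divide_distrib)
      also have "\<dots> \<le> 1" 
      proof -
        have "?X \<le> l powr p" using lp Y0 by linarith
        moreover have "0 < l powr p" using l0 by simp
        ultimately show ?thesis by (simp only: divide_le_eq_1_pos)
      qed
      finally show ?thesis .
    qed
    have var: "real k / real n * (\<Sum>j<n. (u j)\<^sup>2) \<le> 1"
    proof -
      let ?V = "real k / real n * (\<Sum>j<n. (v j)\<^sup>2)"
      have V0: "0 \<le> ?V" by (intro mult_nonneg_nonneg sum_nonneg) auto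
      have "?V powr (p / 2) \<le> l powr p" using lp X0 by (simp only: powr_mult)
      also have "l powr p = (l\<^sup>2) powr (p / 2)"
        using l0 by (simp add: powr_powr flip: powr_numeral)
      finally have "?V \<le> l\<^sup>2" using powr_less_mono2[of "p / 2" "l\<^sup>2" ?V] p by force
      then have "?V / l\<^sup>2 \<le> 1" using l0 by (simp only: divide_le_eq_1_pos zero_less_power)
      then show ?thesis by (simp add: u_def power_divide flip: sum_divide_distrib)
    qed
    have "\<bar>\<Sum>j\<in>S. of_int (eps j) * v j\<bar> powr p = l powr p * \<bar>\<Sum>j\<in>S. of_int (eps j) * u j\<bar> powr p" for S and eps :: "nat \<Rightarrow> int"
    proof -
      have "(\<Sum>j\<in>S. of_int (eps j) * v j) = l * (\<Sum>j\<in>S. of_int (eps j) * u j)"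
        by (simp add: vu sum_distrib_left mult_ac)
      then show ?thesis using l0 by (simp add: abs_mult powr_mult)
    qed
    then have "?lhs = l powr p * (\<Sum>S | S \<subseteq> {..<n} \<and> card S = k. \<Sum>eps\<in>signs n. \<bar>\<Sum>j\<in>S. of_int (eps j) * u j\<bar> powr p)"
      by (simp only: sum_distrib_left)
    also have "\<dots> \<le> l powr p * ?C"
      by (intro mult_left_mono Rosenthal_subset_normalized[OF k p var mom]) auto
    finally show ?thesis using lp by (simp add: mult.commute)
  qed
qed

text \<open>Signs are orthogonal, so the sum of squares is the second moment of the signed sum, and
  Jensen's inequality with exponent p / 2 >= 1 raises it to the p-th moment. In this way the
  variance term of Rosenthal's inequality becomes a quantity that can be linearized
  backwards.\<close>

lemma sum_squares_powr_le_sum_signs: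
  fixes v :: "nat \<Rightarrow> real"
  assumes p: "2 \<le> p"
  shows "2 ^ n * (\<Sum>j<n. (v j)\<^sup>2) powr (p / 2) \<le> (\<Sum>eps\<in>signs n. \<bar>\<Sum>j<n. of_int (eps j) * v j\<bar> powr p)"
proof -
  have orth: "(\<Sum>eps\<in>signs n. real_of_int (eps i) * real_of_int (eps j)) = (if i = j then 2 ^ n else 0)"
    if "i < n" "j < n" for i j
  proof -
    have "(\<Sum>eps\<in>signs n. real_of_int (eps i) * real_of_int (eps j))
       = (\<Sum>eps\<in>signs n. \<Prod>l<n. (if l = i then of_int (eps l) else 1) * (if l = j then of_int (eps l) else 1))"
      using that by (simp add: prod.distrib)
    also have "\<dots> = (\<Prod>l<n. (if l = i then -1 else 1) * (if l = j then -1 else 1) + 1)"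
      by (subst sum_signs_prod[where \<phi> = "\<lambda>l s. (if l = i then of_int s else 1) * (if l = j then of_int s else 1)"])
         (auto intro!: prod.cong)
    also have "\<dots> = (if i = j then 2 ^ n else 0)"
    proof (cases "i = j")
      case True
      then have "(\<Prod>l<n. (if l = i then -1 else 1) * (if l = j then -1 else 1) + 1) = (\<Prod>l<n. (2::real))"
        by (intro prod.cong) auto
      then show ?thesis using True by simp
    next
      case False
      then show ?thesis using that by (auto intro!: prod_zero bexI[of _ i])
    qed
    finally show ?thesis .
  qed
  have "(\<Sum>eps\<in>signs n. (\<Sum>j<n. of_int (eps j) * v j)\<^sup>2)
     = (\<Sum>eps\<in>signs n. \<Sum>i<n. \<Sum>j<n. v i * v j * (of_int (eps i) * of_int (eps j)))"
    by (simp add: power2_eq_square sum_product mult_ac)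
  also have "\<dots> = (\<Sum>i<n. \<Sum>j<n. v i * v j * (\<Sum>eps\<in>signs n. of_int (eps i) * of_int (eps j)))"
    by (simp add: sum.swap[of _ "{..<n}" "signs n"] sum_distrib_left)
  also have "\<dots> = (\<Sum>i<n. \<Sum>j<n. if i = j then v i * v j * 2 ^ n else 0)"
    by (intro sum.cong refl) (simp add: orth)
  also have "\<dots> = 2 ^ n * (\<Sum>j<n. (v j)\<^sup>2)"
    by (simp add: sum_distrib_left power2_eq_square mult_ac)
  finally have E: "2 ^ n * (\<Sum>j<n. (v j)\<^sup>2) = (\<Sum>eps\<in>signs n. 1 * (\<Sum>j<n. of_int (eps j) * v j)\<^sup>2)" by simp
  have "(2 ^ n * (\<Sum>j<n. (v j)\<^sup>2)) powr (p / 2)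
     \<le> (2 ^ n) powr (p / 2 - 1) * (\<Sum>eps\<in>signs n. (\<Sum>j<n. of_int (eps j) * v j)\<^sup>2 powr (p / 2))"
    unfolding E using abs_weighted_sum_powr_le[of "signs n" "p / 2" "\<lambda>_. 1" "2 ^ n" "\<lambda>eps. (\<Sum>j<n. of_int (eps j) * v j)\<^sup>2"] p
    by (simp add: sum_nonneg)
  also have "(\<Sum>eps\<in>signs n. (\<Sum>j<n. of_int (eps j) * v j)\<^sup>2 powr (p / 2)) = (\<Sum>eps\<in>signs n. \<bar>\<Sum>j<n. of_int (eps j) * v j\<bar> powr p)"
  proof (rule sum.cong[OF refl])
    fix eps :: "nat \<Rightarrow> int"
    have "(x\<^sup>2) powr (p / 2) = \<bar>x\<bar> powr p" for x :: real
      using powr_powr[of "\<bar>x\<bar>" 2 "p / 2"] by simp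
    then show "(\<Sum>j<n. of_int (eps j) * v j)\<^sup>2 powr (p / 2) = \<bar>\<Sum>j<n. of_int (eps j) * v j\<bar> powr p" .
  qed
  finally have "(2 ^ n) powr (p / 2) * (\<Sum>j<n. (v j)\<^sup>2) powr (p / 2)
     \<le> (2 ^ n) powr (p / 2 - 1) * (\<Sum>eps\<in>signs n. \<bar>\<Sum>j<n. of_int (eps j) * v j\<bar> powr p)"
    by (simp only: powr_mult)
  moreover have "(2 ^ n) powr (p / 2) = (2 ^ n) powr (p / 2 - 1) * (2 ^ n :: real)"
    by (simp add: powr_diff)
  ultimately show ?thesis by (simp add: mult.assoc)
qed

section \<open>A tent kernel\<close>

definition tent :: "nat \<Rightarrow> int \<Rightarrow> real" where
  "tent R y = max 0 (real R - of_int \<bar>y\<bar>)"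

text \<open>Closed form of the sum of the squared tent values, R^2 + 2 (1^2 + ... + (R -
  1)^2).\<close>

definition tent_mass :: "nat \<Rightarrow> real" where
  "tent_mass R = (2 * real R ^ 3 + real R) / 3"

lemma sum_symmetric_int:
  fixes F :: "int \<Rightarrow> real"
  shows "(\<Sum>y\<in>{- int Q..int Q}. F y) = F 0 + (\<Sum>i<Q. F (int (Suc i)) + F (- int (Suc i)))"
proof (induction Q)
  case (Suc Q)
  have "{- int (Suc Q)..int (Suc Q)} = insert (int (Suc Q)) (insert (- int (Suc Q)) {- int Q..int Q})"
    by auto
  then show ?case using Suc by simp
qed simp

lemma sum_squares_lessThan: "(\<Sum>i<R. (real i)\<^sup>2) = (2 * real R ^ 3 - 3 * (real R)\<^sup>2 + real R) / 6"
  by (induction R) (auto simp: power2_eq_square power3_eq_cube field_simps)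

text \<open>The summation range reaches one past R on both sides, so neither the support of F nor
  its translate is cut off.\<close>

lemma sum_int_shift:
  fixes F :: "int \<Rightarrow> real"
  assumes F: "\<And>y. F y \<noteq> 0 \<Longrightarrow> \<bar>y\<bar> \<le> int R" and s: "\<bar>s\<bar> \<le> 1"
    and F': "\<And>y. F y \<noteq> 0 \<Longrightarrow> \<bar>y - s\<bar> \<le> int R"
  shows "(\<Sum>y\<in>{- int (Suc R)..int (Suc R)}. F (y + s)) = (\<Sum>y\<in>{- int (Suc R)..int (Suc R)}. F y)"
proof -
  let ?I = "{- int (Suc R)..int (Suc R)}"
  show ?thesis
  proof (rule sum.reindex_bij_witness_not_neutral
      [where S' = "{y\<in>?I. F (y + s) = 0}" and T' = "{y\<in>?I. F y = 0}" and i = "\<lambda>y. y - s" and j = "\<lambda>y. y + s"])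
    fix a assume "a \<in> ?I - {y\<in>?I. F (y + s) = 0}"
    then show "a + s \<in> ?I - {y\<in>?I. F y = 0}" using F[of "a + s"] by auto
  next
    fix a assume "a \<in> ?I - {y\<in>?I. F y = 0}"
    then show "a - s \<in> ?I - {y\<in>?I. F (y + s) = 0}" using F'[of a] by auto
  qed (auto intro!: finite_subset[of _ ?I])
qed

lemma tent_nonzero: "tent R y \<noteq> 0 \<Longrightarrow> \<bar>y\<bar> < int R"
  by (auto simp: tent_def max_def split: if_splits)

lemma sum_tent_square:
  assumes "1 \<le> R" "\<bar>s\<bar> \<le> 1"
  shows "(\<Sum>y\<in>{- int (Suc R)..int (Suc R)}. (tent R (y + s))\<^sup>2) = tent_mass R"
proof -
  have "(\<Sum>y\<in>{- int (Suc R)..int (Suc R)}. (tent R (y + s))\<^sup>2) = (\<Sum>y\<in>{- int (Suc R)..int (Suc R)}. (tent R y)\<^sup>2)"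
    by (rule sum_int_shift[where F = "\<lambda>y. (tent R y)\<^sup>2"]) (use assms tent_nonzero in fastforce)+
  also have "\<dots> = (real R)\<^sup>2 + (\<Sum>i<R. 2 * (real (R - Suc i))\<^sup>2)"
    by (subst sum_symmetric_int) (auto simp: tent_def of_nat_diff intro!: sum.cong)
  also have "(\<Sum>i<R. 2 * (real (R - Suc i))\<^sup>2) = 2 * (\<Sum>i<R. (real i)\<^sup>2)"
    using sum.nat_diff_reindex[of "\<lambda>i. 2 * (real i)\<^sup>2" R] by (simp only: sum_distrib_left)
  also have "(real R)\<^sup>2 + \<dots> = tent_mass R"
    unfolding sum_squares_lessThan tent_mass_def by (simp add: field_simps)
  finally show ?thesis .
qed

text \<open>The loss R is half the squared L_2 norm of \<open>tent R (y + 1) - tent R y\<close>,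
  which is 1 or -1 at exactly 2 R points.\<close>

lemma sum_tent_shift1:
  assumes R: "1 \<le> R" and s: "\<bar>s\<bar> = 1"
  shows "(\<Sum>y\<in>{- int (Suc R)..int (Suc R)}. tent R y * tent R (y + s)) = tent_mass R - real R"
proof -
  let ?I = "{- int (Suc R)..int (Suc R)}"
  have "(\<Sum>y\<in>?I. tent R y * tent R (y - 1)) = real R * (real R - 1) + (\<Sum>i<R. 2 * (real (R - Suc i))\<^sup>2)"
  proof (subst sum_symmetric_int)
    have "tent R (int (Suc i)) * tent R (int (Suc i) - 1) + tent R (- int (Suc i)) * tent R (- int (Suc i) - 1)
        = 2 * (real (R - Suc i))\<^sup>2" if "i < R" for i
    proof (cases "R = Suc i")
      case False
      then have "Suc (Suc i) \<le> R" using that by simp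
      then show ?thesis by (auto simp: tent_def max_def of_nat_diff power2_eq_square algebra_simps)
    qed (simp add: tent_def)
    then show "tent R 0 * tent R (0 - 1) + (\<Sum>i<Suc R. tent R (int (Suc i)) * tent R (int (Suc i) - 1)
        + tent R (- int (Suc i)) * tent R (- int (Suc i) - 1))
        = real R * (real R - 1) + (\<Sum>i<R. 2 * (real (R - Suc i))\<^sup>2)"
      using R by (auto simp: tent_def max_def intro!: sum.cong)
  qed
  also have "(\<Sum>i<R. 2 * (real (R - Suc i))\<^sup>2) = 2 * (\<Sum>i<R. (real i)\<^sup>2)"
    using sum.nat_diff_reindex[of "\<lambda>i. 2 * (real i)\<^sup>2" R] by (simp only: sum_distrib_left)
  also have "real R * (real R - 1) + \<dots> = tent_mass R - real R"
    unfolding sum_squares_lessThan tent_mass_def by (simp add: field_simps power2_eq_square)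
  finally have m: "(\<Sum>y\<in>?I. tent R y * tent R (y - 1)) = tent_mass R - real R" .
  consider "s = 1" | "s = - 1" using s by linarith
  then show ?thesis
  proof cases
    case 1
    have "(\<Sum>y\<in>?I. tent R (y + 1) * tent R (y + 1 - 1)) = (\<Sum>y\<in>?I. tent R y * tent R (y - 1))"
      by (rule sum_int_shift[where F = "\<lambda>y. tent R y * tent R (y - 1)"]) (use tent_nonzero in fastforce)+
    then show ?thesis using m 1 by (simp add: mult.commute)
  qed (use m in simp)
qed

text \<open>The loss 4 R - 3 is half the squared L_2 norm of
  \<open>tent R (y + 1) - tent R (y - 1)\<close>: this difference has 2 (R - 1) values of modulus 2,
  two of modulus 1 at the ends of the support, and vanishes at the peak. Up to the 3 it is four
  times the loss at distance 1.\<close>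

lemma sum_tent_shift2:
  assumes R: "1 \<le> R" and s: "\<bar>s\<bar> = 1"
  shows "(\<Sum>y\<in>{- int (Suc R)..int (Suc R)}. tent R (y - s) * tent R (y + s)) = tent_mass R - 4 * real R + 3"
proof -
  let ?I = "{- int (Suc R)..int (Suc R)}"
  \<comment> \<open>With a = R - Suc i the product of the two tent values is (a - 1) (a + 1) = a^2 -
    1, except for a = 0, where the tent is clipped at 0; the \<open>if\<close> corrects that
    case.\<close>
  have "(\<Sum>y\<in>?I. tent R (y - 1) * tent R (y + 1)) = (real R - 1)\<^sup>2 + (\<Sum>i<R. 2 * ((real (R - Suc i))\<^sup>2 - 1 + (if R - Suc i = 0 then 1 else 0)))"
  proof (subst sum_symmetric_int)
    have "tent R (int (Suc i) - 1) * tent R (int (Suc i) + 1) + tent R (- int (Suc i) - 1) * tent R (- int (Suc i) + 1)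
        = 2 * ((real (R - Suc i))\<^sup>2 - 1 + (if R - Suc i = 0 then 1 else 0))" if "i < R" for i
    proof (cases "R = Suc i")
      case False
      then have "Suc (Suc i) \<le> R" using that by simp
      then show ?thesis by (auto simp: tent_def max_def of_nat_diff power2_eq_square algebra_simps)
    qed (simp add: tent_def)
    then show "tent R (0 - 1) * tent R (0 + 1) + (\<Sum>i<Suc R. tent R (int (Suc i) - 1) * tent R (int (Suc i) + 1)
        + tent R (- int (Suc i) - 1) * tent R (- int (Suc i) + 1))
        = (real R - 1)\<^sup>2 + (\<Sum>i<R. 2 * ((real (R - Suc i))\<^sup>2 - 1 + (if R - Suc i = 0 then 1 else 0)))"
      using R by (auto simp: tent_def max_def power2_eq_square intro!: sum.cong)
  qed
  also have "(\<Sum>i<R. 2 * ((real (R - Suc i))\<^sup>2 - 1 + (if R - Suc i = 0 then 1 else 0)))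
      = (\<Sum>i<R. 2 * ((real i)\<^sup>2 - 1 + (if i = 0 then 1 else 0)))"
    by (rule sum.nat_diff_reindex[of "\<lambda>i. 2 * ((real i)\<^sup>2 - 1 + (if i = 0 then 1 else 0))"])
  also have "\<dots> = 2 * ((\<Sum>i<R. (real i)\<^sup>2) - real R + 1)"
    using R by (simp add: sum_distrib_left[symmetric] sum.distrib sum_subtractf)
  also have "(real R - 1)\<^sup>2 + \<dots> = tent_mass R - 4 * real R + 3"
    unfolding sum_squares_lessThan tent_mass_def by (simp add: field_simps power2_eq_square)
  finally have m: "(\<Sum>y\<in>?I. tent R (y - 1) * tent R (y + 1)) = tent_mass R - 4 * real R + 3" .
  consider "s = 1" | "s = - 1" using s by linarith
  then show ?thesis using m by cases (auto simp: mult.commute)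
qed

lemma tent_mass_ge: "2 * real R ^ 3 / 3 \<le> tent_mass R"
  by (simp add: tent_mass_def)

text \<open>The quadratic term must be kept: in the kernel estimate the zeroth and leading first
  orders cancel, so the upper bound has to be exact to first order.\<close>

lemma one_minus_power_le:
  fixes b :: real
  assumes "0 \<le> b" "b \<le> 1"
  shows "(1 - b) ^ N \<le> 1 - real N * b + (real N * b)\<^sup>2 / 2"
proof (induction N)
  case (Suc N)
  have "(1 - b) ^ Suc N \<le> (1 - b) * (1 - real N * b + (real N * b)\<^sup>2 / 2)"
    using Suc assms by (simp add: mult_left_mono)
  also have "\<dots> = 1 - real (Suc N) * b + (real (Suc N) * b)\<^sup>2 / 2 - b\<^sup>2 / 2 - real N * real N * (b * b * b) / 2"
    by (simp add: power2_eq_square field_simps)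
  also have "\<dots> \<le> 1 - real (Suc N) * b + (real (Suc N) * b)\<^sup>2 / 2"
  proof -
    have "0 \<le> b\<^sup>2" "0 \<le> real N * real N * (b * b * b)" using assms by auto
    then show ?thesis by linarith
  qed
  finally show ?case .
qed simp

lemma one_minus_power_ge:
  fixes b :: real
  assumes "b \<le> 1"
  shows "1 - real N * b \<le> (1 - b) ^ N"
  using Bernoulli_inequality[of "- b" N] assms by simp

section \<open>The product kernel and its second differences\<close>

text \<open>The box is larger than the support |y i| < n of the kernel, so that a shift with entries
  in {-1, 0, 1} keeps the support inside.\<close>

definition kernel_box :: "nat \<Rightarrow> (nat \<Rightarrow> int) set" where
  "kernel_box n = {..<n} \<rightarrow>\<^sub>E {- int (Suc n)..int (Suc n)}"

definition kernel :: "nat \<Rightarrow> (nat \<Rightarrow> int) \<Rightarrow> real" where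
  "kernel n y = (\<Prod>i<n. (tent n (y i))\<^sup>2 / tent_mass n)"

lemma finite_kernel_box [simp]: "finite (kernel_box n)"
  unfolding kernel_box_def by (intro finite_PiE) auto

lemma sum_kernel_box_prod:
  fixes \<phi> :: "nat \<Rightarrow> int \<Rightarrow> real"
  shows "(\<Sum>y\<in>kernel_box n. \<Prod>i<n. \<phi> i (y i)) = (\<Prod>i<n. \<Sum>s\<in>{- int (Suc n)..int (Suc n)}. \<phi> i s)"
  unfolding kernel_box_def by (rule prod_sum_PiE[symmetric]) auto

lemma tent_mass_nonneg: "0 \<le> tent_mass n"
  by (simp add: tent_mass_def)

lemma tent_mass_pos: "1 \<le> n \<Longrightarrow> 0 < tent_mass n"
  by (simp add: tent_mass_def add_pos_pos)

lemma kernel_nonneg: "0 \<le> kernel n y"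
  unfolding kernel_def by (intro prod_nonneg) (simp add: tent_mass_nonneg)

lemma kernel_nonzero: "kernel n y \<noteq> 0 \<Longrightarrow> i < n \<Longrightarrow> \<bar>y i\<bar> < int n"
  unfolding kernel_def using tent_nonzero by fastforce

lemma sum_kernel:
  assumes "1 \<le> n"
  shows "(\<Sum>y\<in>kernel_box n. kernel n y) = 1"
proof -
  have "(\<Sum>y\<in>kernel_box n. kernel n y) = (\<Prod>i<n. \<Sum>s\<in>{- int (Suc n)..int (Suc n)}. (tent n s)\<^sup>2 / tent_mass n)"
    unfolding kernel_def by (rule sum_kernel_box_prod)
  also have "\<dots> = (\<Prod>i<n. 1)"
    using sum_tent_square[OF assms, of 0] tent_mass_pos[OF assms]
    by (intro prod.cong refl) (simp add: sum_divide_distrib[symmetric])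
  finally show ?thesis by simp
qed

text \<open>The kernel is the square of a product function \<open>G\<close>, so its second difference along \<open>z\<close> is
  controlled in \<open>L\<^sub>1\<close> by first and second differences of \<open>G\<close> in \<open>L\<^sub>2\<close>, through
  \<open>a\<^sup>2 + b\<^sup>2 - 2 c\<^sup>2 = (a + b - 2 c) (a + b + 2 c) / 2 + (a - b)\<^sup>2 / 2\<close>. The \<open>L\<^sub>2\<close> inner products factor over
  coordinates, and this is what makes the bound \<open>O(1 / n)\<close> although \<open>z\<close> may have \<open>n\<close> nonzero entries.\<close>
lemma kernel_second_difference:
  fixes z :: "nat \<Rightarrow> int"
  assumes n: "1 \<le> n" and z: "\<And>i. i < n \<Longrightarrow> \<bar>z i\<bar> \<le> 1"
  shows "(\<Sum>y\<in>kernel_box n. \<bar>kernel n (y - z) + kernel n (y + z) - 2 * kernel n y\<bar>) \<le> 22 / real n"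
proof -
  define Z where "Z = tent_mass n"
  define G where "G = (\<lambda>y. \<Prod>i<n. tent n (y i) / sqrt Z)"
  \<comment> \<open>Correlations of the L_2-normalized tent at distances 1 and 2. Only the N
    coordinates moved by z contribute such a factor to an inner product of translates of
    \<open>G\<close>.\<close>
  define r1 where "r1 = 1 - real n / Z"
  define r2 where "r2 = 1 - (4 * real n - 3) / Z"
  define A where "A = {i\<in>{..<n}. z i \<noteq> 0}"
  define N where "N = card A"
  let ?I = "{- int (Suc n)..int (Suc n)}"
  have Z: "0 < Z" using tent_mass_pos[OF n] by (simp add: Z_def)
  have An: "A \<subseteq> {..<n}" by (auto simp: A_def)
  have Nn: "N \<le> n" unfolding N_def using card_mono[OF _ An] by simp
  have kG: "kernel n y = (G y)\<^sup>2" for y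
    using Z by (simp add: kernel_def G_def prod_power_distrib power_divide Z_def)
  have prodA: "(\<Prod>i<n. if z i = 0 then 1 else r) = r ^ N" for r :: real
  proof -
    have "(\<Prod>i<n. if z i = 0 then 1 else r) = (\<Prod>i\<in>A. r)"
      by (rule prod.mono_neutral_cong_right) (auto simp: A_def)
    then show ?thesis by (simp add: N_def)
  qed
  have GG: "(\<Sum>y\<in>kernel_box n. G (\<lambda>i. y i + a i) * G (\<lambda>i. y i + b i)) = r ^ N"
    if "\<And>i. i < n \<Longrightarrow> (\<Sum>s\<in>?I. tent n (s + a i) * tent n (s + b i)) = Z * (if z i = 0 then 1 else r)" for a b r
  proof -
    have "(\<Sum>y\<in>kernel_box n. G (\<lambda>i. y i + a i) * G (\<lambda>i. y i + b i))
      = (\<Sum>y\<in>kernel_box n. \<Prod>i<n. tent n (y i + a i) * tent n (y i + b i) / Z)"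
      using Z by (simp add: G_def flip: prod.distrib)
    also have "\<dots> = (\<Prod>i<n. \<Sum>s\<in>?I. tent n (s + a i) * tent n (s + b i) / Z)"
      by (rule sum_kernel_box_prod[where \<phi> = "\<lambda>i s. tent n (s + a i) * tent n (s + b i) / Z"])
    also have "\<dots> = (\<Prod>i<n. if z i = 0 then 1 else r)"
      by (intro prod.cong refl) (use that Z in \<open>simp add: sum_divide_distrib[symmetric]\<close>)
    finally show ?thesis using prodA by simp
  qed
  have sq: "(\<Sum>s\<in>?I. tent n (s + a) * tent n (s + a)) = Z" if "\<bar>a\<bar> \<le> 1" for a
    using sum_tent_square[OF n that] by (simp add: Z_def power2_eq_square)
  have z3: "z i = 0 \<or> \<bar>z i\<bar> = 1" if "i < n" for i using z[OF that] by linarith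
  have nz: "(y - z) = (\<lambda>i. y i + (- z i))" "(y + z) = (\<lambda>i. y i + z i)" for y
    by (auto simp: fun_eq_iff)
  have aa: "(\<Sum>y\<in>kernel_box n. G (y - z) * G (y - z)) = 1"
    using GG[where r = 1 and a = "\<lambda>i. - z i" and b = "\<lambda>i. - z i"] sq[of "- z i" for i] z unfolding nz by simp
  have bb: "(\<Sum>y\<in>kernel_box n. G (y + z) * G (y + z)) = 1"
    using GG[where r = 1 and a = z and b = z] sq[of "z i" for i] z unfolding nz by simp
  have cc: "(\<Sum>y\<in>kernel_box n. G y * G y) = 1"
    using GG[where r = 1 and a = "\<lambda>_. 0" and b = "\<lambda>_. 0"] sq[of 0] by simp
  have t1: "(\<Sum>s\<in>?I. tent n s * tent n (s + a)) = Z * (if a = 0 then 1 else r1)" if "a = 0 \<or> \<bar>a\<bar> = 1" for a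
    using that sum_tent_shift1[OF n, of a] sq[of 0] Z by (auto simp: r1_def Z_def right_diff_distrib)
  have ac: "(\<Sum>y\<in>kernel_box n. G y * G (y - z)) = r1 ^ N"
    using GG[where r = r1 and a = "\<lambda>_. 0" and b = "\<lambda>i. - z i"] t1[of "- z i" for i] z3 unfolding nz by simp
  have bc: "(\<Sum>y\<in>kernel_box n. G y * G (y + z)) = r1 ^ N"
    using GG[where r = r1 and a = "\<lambda>_. 0" and b = z] t1[of "z i" for i] z3 unfolding nz by simp
  have t2: "(\<Sum>s\<in>?I. tent n (s + - a) * tent n (s + a)) = Z * (if a = 0 then 1 else r2)" if "a = 0 \<or> \<bar>a\<bar> = 1" for a
    using that sum_tent_shift2[OF n, of a] sq[of 0] Z by (auto simp: r2_def Z_def right_diff_distrib diff_divide_distrib)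
  have ab: "(\<Sum>y\<in>kernel_box n. G (y - z) * G (y + z)) = r2 ^ N"
    using GG[where r = r2 and a = "\<lambda>i. - z i" and b = z] t2[of "z i" for i] z3 unfolding nz by simp

  have n1: "1 \<le> real n" using n by simp
  have Zge: "2 * real n ^ 3 / 3 \<le> Z" using tent_mass_ge by (simp add: Z_def)
  have b_le: "(4 * real n - 3) / Z \<le> 6 / (real n)\<^sup>2"
  proof -
    have "(4 * real n - 3) * (real n)\<^sup>2 \<le> 6 * (2 * real n ^ 3 / 3)"
      by (simp add: power2_eq_square power3_eq_cube algebra_simps)
    also have "\<dots> \<le> 6 * Z" using Zge by simp
    finally show ?thesis using Z n1 by (simp add: divide_simps mult.commute)
  qed
  have b0: "0 \<le> (4 * real n - 3) / Z" using Z n1 by simp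
  have b1: "(4 * real n - 3) / Z \<le> 1"
  proof -
    \<comment> \<open>After multiplication by 3, the claim 4 n - 3 <= Z reads 0 <= 2 n^3 - 11 n + 9,
      and the right-hand side factors in this way.\<close>
    have "0 \<le> (real n - 1) * (2 * (real n)\<^sup>2 + 2 * real n - 9) \<or> n = 1 "
    proof (cases "n = 1")
      case False
      then have "2 \<le> real n" using n by simp
      then have "2 * 2 \<le> real n * real n" by (intro mult_mono) auto
      then show ?thesis using \<open>2 \<le> real n\<close> by (simp add: power2_eq_square)
    qed simp
    then have "3 * (4 * real n - 3) \<le> 2 * real n ^ 3 + real n"
      by (auto simp: power2_eq_square power3_eq_cube algebra_simps)
    then have "4 * real n - 3 \<le> Z" by (simp add: Z_def tent_mass_def)
    then show ?thesis using Z by simp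
  qed
  have a1: "real n / Z \<le> 1"
  proof -
    have "3 * real n \<le> 2 * real n ^ 3 + real n"
      using n1 mult_mono[OF n1 n1] mult_left_mono[of 1 "real n * real n" "real n"]
      by (simp add: power3_eq_cube mult.assoc)
    then have "real n \<le> Z" by (simp add: Z_def tent_mass_def)
    then show ?thesis using Z by simp
  qed
  have Nr: "real N \<le> real n" using Nn by simp
  have bernoulli: "1 - real N * ((4 * real n - 3) / Z) \<le> r2 ^ N"
    unfolding r2_def by (rule one_minus_power_ge[OF b1])
  have Nb: "real N * ((4 * real n - 3) / Z) \<le> 6 / real n"
  proof -
    have "real N * ((4 * real n - 3) / Z) \<le> real n * (6 / (real n)\<^sup>2)"
      by (intro mult_mono Nr b_le b0) auto
    then show ?thesis using n1 by (simp add: power2_eq_square)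
  qed
  \<comment> \<open>The left side is the squared L_2 norm of the second difference of
    \<open>G\<close>. Constants cancel as 6 + 2 - 8; at first order the 8 N n / Z cancel and only 6
    N / Z = O(1 / n^2) survives; the second order is (6 / n)^2. Thus 45 = 9 + 36.\<close>
  have U: "6 + 2 * r2 ^ N - 8 * r1 ^ N \<le> 45 / (real n)\<^sup>2"
  proof -
    have "6 + 2 * r2 ^ N - 8 * r1 ^ N \<le> 6 + 2 * (1 - real N * ((4 * real n - 3) / Z) + (real N * ((4 * real n - 3) / Z))\<^sup>2 / 2)
        - 8 * (1 - real N * (real n / Z))"
      unfolding r1_def r2_def
      by (intro diff_mono add_mono mult_left_mono one_minus_power_le[OF b0 b1] one_minus_power_ge[OF a1]) auto
    also have "\<dots> = real N * (6 / Z) + (real N * ((4 * real n - 3) / Z))\<^sup>2"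
      by (simp add: diff_divide_distrib algebra_simps)
    also have "\<dots> \<le> 9 / (real n)\<^sup>2 + (6 / real n)\<^sup>2"
    proof (rule add_mono)
      have "real N * (6 / Z) \<le> real n * (6 / (2 * real n ^ 3 / 3))"
        using n1 Z less_imp_le[OF Z] by (intro mult_mono Nr divide_left_mono Zge) (auto intro!: mult_pos_pos)
      then show "real N * (6 / Z) \<le> 9 / (real n)\<^sup>2"
        using n1 by (simp add: power2_eq_square power3_eq_cube field_simps)
      show "(real N * ((4 * real n - 3) / Z))\<^sup>2 \<le> (6 / real n)\<^sup>2"
        using Nb b0 by (intro power_mono mult_nonneg_nonneg) auto
    qed
    also have "\<dots> = 45 / (real n)\<^sup>2" by (simp add: power_divide add_divide_distrib[symmetric])
    finally show ?thesis .
  qed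
  let ?u = "\<lambda>y. G (y - z) + G (y + z) - 2 * G y" and ?v = "\<lambda>y. G (y - z) + G (y + z) + 2 * G y"
    and ?w = "\<lambda>y. G (y - z) - G (y + z)"
  \<comment> \<open>The weights are chosen because the squared norm of u is O(1 / n^2) and that of v
    is O(1): the factor n brings both contributions to O(1 / n).\<close>
  have amgm: "\<bar>u * v\<bar> / 2 \<le> (real n / 4) * u\<^sup>2 + (1 / (4 * real n)) * v\<^sup>2" for u v :: real
  proof -
    have "0 \<le> (real n * \<bar>u\<bar> - \<bar>v\<bar>)\<^sup>2" by simp
    then have "2 * real n * \<bar>u * v\<bar> \<le> (real n)\<^sup>2 * u\<^sup>2 + v\<^sup>2"
      by (simp add: power2_diff power_mult_distrib abs_mult mult.assoc)
    then show ?thesis using n1 by (simp add: field_simps power2_eq_square)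
  qed
  have pw: "\<bar>kernel n (y - z) + kernel n (y + z) - 2 * kernel n y\<bar>
      \<le> (real n / 4) * (?u y)\<^sup>2 + (1 / (4 * real n)) * (?v y)\<^sup>2 + (1/2) * (?w y)\<^sup>2" for y
  proof -
    have e: "kernel n (y - z) + kernel n (y + z) - 2 * kernel n y = (?u y * ?v y) / 2 + (?w y)\<^sup>2 / 2"
      unfolding kG by (simp add: power2_eq_square field_simps)
    have "\<bar>?u y * ?v y\<bar> / 2 \<le> (real n / 4) * (?u y)\<^sup>2 + (1 / (4 * real n)) * (?v y)\<^sup>2"
      by (rule amgm)
    moreover have "\<bar>(?u y * ?v y) / 2 + (?w y)\<^sup>2 / 2\<bar> \<le> \<bar>?u y * ?v y\<bar> / 2 + (?w y)\<^sup>2 / 2"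
      by (rule order.trans[OF abs_triangle_ineq]) simp
    ultimately show ?thesis unfolding e by linarith
  qed
  have su: "(\<Sum>y\<in>kernel_box n. (?u y)\<^sup>2) = 6 + 2 * r2 ^ N - 8 * r1 ^ N"
  proof -
    have "(?u y)\<^sup>2 = G (y - z) * G (y - z) + G (y + z) * G (y + z) + 4 * (G y * G y) + 2 * (G (y - z) * G (y + z))
        - 4 * (G y * G (y - z)) - 4 * (G y * G (y + z))" for y
      by (simp add: power2_eq_square algebra_simps)
    then show ?thesis
      by (simp add: sum.distrib sum_subtractf sum_distrib_left[symmetric] aa bb cc ab ac bc)
  qed
  have sv: "(\<Sum>y\<in>kernel_box n. (?v y)\<^sup>2) \<le> 16"
  proof -
    have "(a + b + 2 * c)\<^sup>2 \<le> 4 * (a * a) + 4 * (b * b) + 8 * (c * c)" for a b c :: real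
    proof -
      have "0 \<le> (a - b)\<^sup>2 + 2 * (a - c)\<^sup>2 + 2 * (b - c)\<^sup>2" by simp
      then show ?thesis by (simp add: power2_eq_square algebra_simps)
    qed
    then have "(\<Sum>y\<in>kernel_box n. (?v y)\<^sup>2)
       \<le> (\<Sum>y\<in>kernel_box n. 4 * (G (y - z) * G (y - z)) + 4 * (G (y + z) * G (y + z)) + 8 * (G y * G y))"
      by (rule sum_mono)
    also have "\<dots> = 16" by (simp add: sum.distrib sum_distrib_left[symmetric] aa bb cc)
    finally show ?thesis .
  qed
  have sw: "(\<Sum>y\<in>kernel_box n. (?w y)\<^sup>2) = 2 - 2 * r2 ^ N"
  proof -
    have "(?w y)\<^sup>2 = G (y - z) * G (y - z) + G (y + z) * G (y + z) - 2 * (G (y - z) * G (y + z))" for y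
      by (simp add: power2_eq_square algebra_simps)
    then show ?thesis
      by (simp add: sum.distrib sum_subtractf sum_distrib_left[symmetric] aa bb ab)
  qed
  have "(\<Sum>y\<in>kernel_box n. \<bar>kernel n (y - z) + kernel n (y + z) - 2 * kernel n y\<bar>)
     \<le> (\<Sum>y\<in>kernel_box n. (real n / 4) * (?u y)\<^sup>2 + (1 / (4 * real n)) * (?v y)\<^sup>2 + (1/2) * (?w y)\<^sup>2)"
    by (intro sum_mono pw)
  also have "\<dots> = (real n / 4) * (\<Sum>y\<in>kernel_box n. (?u y)\<^sup>2) + (1 / (4 * real n)) * (\<Sum>y\<in>kernel_box n. (?v y)\<^sup>2)
      + (1/2) * (\<Sum>y\<in>kernel_box n. (?w y)\<^sup>2)"
    by (simp only: sum.distrib sum_distrib_left)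
  \<comment> \<open>The three contributions are 45/4, 4 and 6 over n, in total 21.25 / n.\<close>
  also have "\<dots> \<le> (real n / 4) * (45 / (real n)\<^sup>2) + (1 / (4 * real n)) * 16 + (1/2) * (12 / real n)"
    using U Nb bernoulli n1 unfolding su sw by (intro add_mono mult_left_mono sv) auto
  also have "\<dots> \<le> 22 / real n"
    using n1 by (simp add: power2_eq_square field_simps)
  finally show ?thesis .
qed

section \<open>Smoothing on the torus\<close>

text \<open>Functions on the torus are treated as functions on all integer vectors that see only the
  residues of the first n coordinates. Translation is then plain addition, without reduction modulo
  M.\<close>

definition periodic :: "nat \<Rightarrow> nat \<Rightarrow> ((nat \<Rightarrow> int) \<Rightarrow> real) \<Rightarrow> bool" where
  "periodic M n h \<longleftrightarrow> (\<forall>v w. (\<forall>i<n. v i mod int M = w i mod int M) \<longrightarrow> h v = h w)"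

text \<open>A sum rather than a mean: the number of points of the torus is divided out only in the
  theorem.\<close>

definition disp :: "real \<Rightarrow> nat \<Rightarrow> nat \<Rightarrow> ((nat \<Rightarrow> int) \<Rightarrow> real) \<Rightarrow> (nat \<Rightarrow> int) \<Rightarrow> real" where
  "disp p M n h v = (\<Sum>x\<in>torus M n. \<bar>h (x + v) - h x\<bar> powr p)"

lemma periodicD: "periodic M n h \<Longrightarrow> (\<And>i. i < n \<Longrightarrow> v i mod int M = w i mod int M) \<Longrightarrow> h v = h w"
  unfolding periodic_def by blast

lemma periodic_cong: "periodic M n h \<Longrightarrow> (\<And>i. i < n \<Longrightarrow> v i = w i) \<Longrightarrow> h v = h w"
  by (rule periodicD) auto

lemma periodic_shift:
  assumes "periodic M n h"
  shows "periodic M n (\<lambda>x. h (x + a))"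
  unfolding periodic_def
proof (intro allI impI)
  fix v w :: "nat \<Rightarrow> int"
  assume "\<forall>i<n. v i mod int M = w i mod int M"
  then show "h (v + a) = h (w + a)"
    by (intro periodicD[OF assms]) (auto intro!: mod_add_cong)
qed

lemma periodic_map2:
  "periodic M n f \<Longrightarrow> periodic M n g \<Longrightarrow> periodic M n (\<lambda>x. F (f x) (g x))"
  unfolding periodic_def by (auto intro!: arg_cong2[where f = F])

lemma periodic_sum:
  "(\<And>y. y \<in> Y \<Longrightarrow> periodic M n (f y)) \<Longrightarrow> periodic M n (\<lambda>x. \<Sum>y\<in>Y. K y * f y x)"
  unfolding periodic_def by (auto intro!: sum.cong)

lemma finite_torus [simp]: "finite (torus M n)"
  unfolding torus_def by (intro finite_PiE) auto

lemma card_torus: "card (torus M n) = M ^ n"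
  unfolding torus_def by (simp add: card_PiE)

lemma sum_torus_shift:
  assumes M: "0 < M" and h: "periodic M n h"
  shows "(\<Sum>x\<in>torus M n. h (x + a)) = (\<Sum>x\<in>torus M n. h x)"
proof (rule sum.reindex_bij_witness[where
    j = "\<lambda>x. restrict (\<lambda>i. (x i + a i) mod int M) {..<n}" and
    i = "\<lambda>x. restrict (\<lambda>i. (x i - a i) mod int M) {..<n}"])
  fix x assume x: "x \<in> torus M n"
  then have xi: "x i mod int M = x i" if "i < n" for i
    using that by (auto simp: torus_def PiE_iff)
  have ext: "restrict x {..<n} = x" using x by (auto simp: torus_def PiE_iff extensional_restrict)
  have "restrict (\<lambda>i. (restrict (\<lambda>i. (x i + a i) mod int M) {..<n} i - a i) mod int M) {..<n} = restrict x {..<n}"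
    by (rule restrict_ext) (simp add: mod_simps xi)
  then show "restrict (\<lambda>i. (restrict (\<lambda>i. (x i + a i) mod int M) {..<n} i - a i) mod int M) {..<n} = x"
    using ext by simp
  have "restrict (\<lambda>i. (restrict (\<lambda>i. (x i - a i) mod int M) {..<n} i + a i) mod int M) {..<n} = restrict x {..<n}"
    by (rule restrict_ext) (simp add: mod_simps xi)
  then show "restrict (\<lambda>i. (restrict (\<lambda>i. (x i - a i) mod int M) {..<n} i + a i) mod int M) {..<n} = x"
    using ext by simp
  show "restrict (\<lambda>i. (x i + a i) mod int M) {..<n} \<in> torus M n"
    "restrict (\<lambda>i. (x i - a i) mod int M) {..<n} \<in> torus M n"
    using M by (auto simp: torus_def)
  show "h (restrict (\<lambda>i. (x i + a i) mod int M) {..<n}) = h (x + a)"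
    by (rule periodicD[OF h]) simp
qed

lemma sum_torus_disp_shift:
  assumes M: "0 < M" and h: "periodic M n h"
  shows "(\<Sum>x\<in>torus M n. \<bar>h (x + a) - h (x + b)\<bar> powr p) = disp p M n h (a - b)"
proof -
  have "(\<Sum>x\<in>torus M n. \<bar>h (x + b + (a - b)) - h (x + b)\<bar> powr p) = disp p M n h (a - b)"
    unfolding disp_def
    by (rule sum_torus_shift[OF M, where h = "\<lambda>x. \<bar>h (x + (a - b)) - h x\<bar> powr p"])
       (intro periodic_map2[where F = "\<lambda>u v. \<bar>u - v\<bar> powr p"] periodic_shift h)
  moreover have "x + b + (a - b) = x + a" for x by (simp add: fun_eq_iff)
  ultimately show ?thesis by simp
qed

lemma disp_cong:
  assumes "periodic M n h" "\<And>i. i < n \<Longrightarrow> v i = w i"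
  shows "disp p M n h v = disp p M n h w"
  unfolding disp_def using assms by (intro sum.cong refl) (simp add: periodic_cong[of M n h "_ + v" "_ + w"])

lemma disp_minus:
  assumes "0 < M" "periodic M n h"
  shows "disp p M n h (- v) = disp p M n h v"
proof -
  have "disp p M n h v = (\<Sum>x\<in>torus M n. \<bar>h (x + 0) - h (x + v)\<bar> powr p)"
    by (simp add: disp_def abs_minus_commute)
  also have "\<dots> = disp p M n h (- v)" by (subst sum_torus_disp_shift[OF assms]) simp
  finally show ?thesis ..
qed

lemma disp_nonneg: "0 \<le> disp p M n h v"
  unfolding disp_def by (intro sum_nonneg) simp

lemma disp_zero [simp]: "disp p M n h 0 = 0"
  unfolding disp_def by simp

text \<open>Telescope along the path and apply Hoelder's inequality to the N steps; translation
  invariance makes the cost of a step independent of where it starts.\<close>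

lemma disp_path_le:
  fixes q :: "nat \<Rightarrow> nat \<Rightarrow> int"
  assumes M: "0 < M" and h: "periodic M n h" and p: "1 \<le> p"
  shows "(\<Sum>x\<in>torus M n. \<bar>h (x + q N) - h (x + q 0)\<bar> powr p)
    \<le> real N powr (p - 1) * (\<Sum>t<N. disp p M n h (q (Suc t) - q t))"
proof -
  have "\<bar>h (x + q N) - h (x + q 0)\<bar> powr p \<le> real N powr (p - 1) * (\<Sum>t<N. \<bar>h (x + q (Suc t)) - h (x + q t)\<bar> powr p)" for x
    using abs_sum_powr_le[of "{..<N}" p "real N" "\<lambda>t. h (x + q (Suc t)) - h (x + q t)"] p
    by (simp add: sum_lessThan_telescope[of "\<lambda>t. h (x + q t)"])
  then have "(\<Sum>x\<in>torus M n. \<bar>h (x + q N) - h (x + q 0)\<bar> powr p)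
     \<le> (\<Sum>x\<in>torus M n. real N powr (p - 1) * (\<Sum>t<N. \<bar>h (x + q (Suc t)) - h (x + q t)\<bar> powr p))"
    by (rule sum_mono)
  also have "\<dots> = real N powr (p - 1) * (\<Sum>t<N. \<Sum>x\<in>torus M n. \<bar>h (x + q (Suc t)) - h (x + q t)\<bar> powr p)"
    by (subst sum.swap) (simp add: sum_distrib_left)
  finally show ?thesis by (simp add: sum_torus_disp_shift[OF M h])
qed

lemma disp_multiple_le:
  assumes M: "0 < M" and h: "periodic M n h" and p: "1 \<le> p"
  shows "disp p M n h (\<lambda>i. int N * w i) \<le> real N powr p * disp p M n h w"
proof (cases "N = 0")
  case False
  have st: "(\<lambda>i. int (Suc t) * w i) - (\<lambda>i. int t * w i) = w" for t
    by (simp add: fun_eq_iff algebra_simps)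
  have "x + (\<lambda>i. int 0 * w i) = x" for x by (simp add: fun_eq_iff)
  then have "disp p M n h (\<lambda>i. int N * w i)
      = (\<Sum>x\<in>torus M n. \<bar>h (x + (\<lambda>i. int N * w i)) - h (x + (\<lambda>i. int 0 * w i))\<bar> powr p)"
    by (simp only: disp_def)
  also have "\<dots> \<le> real N powr (p - 1) * (\<Sum>t<N. disp p M n h ((\<lambda>i. int (Suc t) * w i) - (\<lambda>i. int t * w i)))"
    by (rule disp_path_le[OF M h p, where q = "\<lambda>t i. int t * w i"])
  also have "\<dots> = real N powr (p - 1) * real N * disp p M n h w"
    unfolding st by simp
  also have "real N powr (p - 1) * real N = real N powr p"
    using False by (simp add: powr_diff)
  finally show ?thesis .
next
  case True
  then have "(\<lambda>i. int N * w i) = 0" by (simp add: fun_eq_iff)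
  then show ?thesis by (simp add: disp_nonneg)
qed

lemma sum_torus_convolution_le:
  fixes K :: "(nat \<Rightarrow> int) \<Rightarrow> real"
  assumes M: "0 < M" and h: "periodic M n h" and p: "1 \<le> p" and Y: "finite Y"
    and C: "(\<Sum>y\<in>Y. \<bar>K y\<bar>) \<le> C"
  shows "(\<Sum>x\<in>torus M n. \<bar>\<Sum>y\<in>Y. K y * h (x + y)\<bar> powr p) \<le> C powr p * (\<Sum>x\<in>torus M n. \<bar>h x\<bar> powr p)"
proof -
  have C0: "0 \<le> C" by (rule order.trans[OF sum_nonneg C]) simp
  have inv: "(\<Sum>x\<in>torus M n. \<bar>h (x + y)\<bar> powr p) = (\<Sum>x\<in>torus M n. \<bar>h x\<bar> powr p)" for y
    by (rule sum_torus_shift[OF M, where h = "\<lambda>x. \<bar>h x\<bar> powr p"])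
       (rule periodic_map2[OF h h, where F = "\<lambda>u v. \<bar>u\<bar> powr p"])
  have "(\<Sum>x\<in>torus M n. \<bar>\<Sum>y\<in>Y. K y * h (x + y)\<bar> powr p)
      \<le> (\<Sum>x\<in>torus M n. C powr (p - 1) * (\<Sum>y\<in>Y. \<bar>K y\<bar> * \<bar>h (x + y)\<bar> powr p))"
    by (intro sum_mono abs_weighted_sum_powr_le Y p C)
  also have "\<dots> = C powr (p - 1) * (\<Sum>y\<in>Y. \<bar>K y\<bar> * (\<Sum>x\<in>torus M n. \<bar>h (x + y)\<bar> powr p))"
    by (simp add: sum_distrib_left[symmetric] sum.swap[of _ Y])
  also have "\<dots> = C powr (p - 1) * ((\<Sum>y\<in>Y. \<bar>K y\<bar>) * (\<Sum>x\<in>torus M n. \<bar>h x\<bar> powr p))"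
    by (simp add: inv sum_distrib_right)
  also have "\<dots> \<le> C powr (p - 1) * (C * (\<Sum>x\<in>torus M n. \<bar>h x\<bar> powr p))"
    by (intro mult_left_mono mult_right_mono C sum_nonneg) auto
  also have "\<dots> = C powr p * (\<Sum>x\<in>torus M n. \<bar>h x\<bar> powr p)"
    using C0 by (cases "C = 0") (simp_all add: powr_diff)
  finally show ?thesis .
qed

definition smooth :: "nat \<Rightarrow> ((nat \<Rightarrow> int) \<Rightarrow> real) \<Rightarrow> (nat \<Rightarrow> int) \<Rightarrow> real" where
  "smooth n h x = (\<Sum>y\<in>kernel_box n. kernel n y * h (x + y))"

lemma periodic_smooth: "periodic M n h \<Longrightarrow> periodic M n (smooth n h)"
  unfolding smooth_def by (intro periodic_sum periodic_shift)

lemma smooth_add_arg: "smooth n h (x + z) = smooth n (\<lambda>x. h (x + z)) x"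
  unfolding smooth_def by (simp add: add_ac)

lemma smooth_diff: "smooth n (\<lambda>x. f x - g x) x = smooth n f x - smooth n g x"
  unfolding smooth_def by (simp add: right_diff_distrib sum_subtractf)

lemma sum_torus_smooth_le:
  assumes "0 < M" "periodic M n h" "1 \<le> p" "1 \<le> n"
  shows "(\<Sum>x\<in>torus M n. \<bar>smooth n h x\<bar> powr p) \<le> (\<Sum>x\<in>torus M n. \<bar>h x\<bar> powr p)"
  unfolding smooth_def
  using sum_torus_convolution_le[OF assms(1-3), of "kernel_box n" "kernel n" 1] sum_kernel[OF assms(4)]
  by (simp add: kernel_nonneg)

lemma disp_smooth_le:
  assumes M: "0 < M" and h: "periodic M n h" and p: "1 \<le> p" and n: "1 \<le> n"
  shows "(\<Sum>x\<in>torus M n. \<bar>smooth n h (x + a) - smooth n h (x + b)\<bar> powr p) \<le> disp p M n h (a - b)"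
proof -
  have "periodic M n (\<lambda>x. h (x + a) - h (x + b))"
    by (intro periodic_map2[where F = "(-)"] periodic_shift h)
  from sum_torus_smooth_le[OF M this p n]
  show ?thesis by (simp add: smooth_diff smooth_add_arg sum_torus_disp_shift[OF M h])
qed

text \<open>Summation by parts on the lattice: the shift passes from h to the kernel, so differences
  of \<open>smooth n h\<close> are small although nothing is known about h. The margin of
  \<open>kernel_box\<close> excludes boundary terms.\<close>

lemma smooth_shift:
  fixes z :: "nat \<Rightarrow> int"
  assumes h: "periodic M n h" and z: "\<And>i. i < n \<Longrightarrow> \<bar>z i\<bar> \<le> 1"
  shows "smooth n h (x + z) = (\<Sum>y\<in>kernel_box n. kernel n (y - z) * h (x + y))"
proof -
  let ?Y = "kernel_box n"
  have kc: "kernel n v = kernel n w" if "\<And>i. i < n \<Longrightarrow> v i = w i" for v w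
    using that unfolding kernel_def by (intro prod.cong refl) simp
  have rc: "restrict (y + z) {..<n} i = y i + z i" "restrict (y - z) {..<n} i = y i - z i" if "i < n" for y i
    using that by auto
  have re: "restrict y {..<n} = y" if "y \<in> ?Y" for y
    using that by (auto simp: kernel_box_def PiE_iff extensional_restrict)
  have mem: "restrict w {..<n} \<in> ?Y" if "\<And>i. i < n \<Longrightarrow> \<bar>w i\<bar> \<le> int (Suc n)" for w
    using that by (fastforce simp: kernel_box_def)
  have "(\<Sum>y\<in>?Y. kernel n y * h (x + z + y)) = (\<Sum>y\<in>?Y. kernel n (y - z) * h (x + y))"
  proof (rule sum.reindex_bij_witness_not_neutral[where S' = "{y\<in>?Y. kernel n y = 0}" and T' = "{y\<in>?Y. kernel n (y - z) = 0}"
        and j = "\<lambda>y. restrict (y + z) {..<n}" and i = "\<lambda>y. restrict (y - z) {..<n}"])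
    fix y assume y: "y \<in> ?Y - {y\<in>?Y. kernel n y = 0}"
    have b: "\<bar>y i + z i\<bar> \<le> int (Suc n)" if "i < n" for i
      using kernel_nonzero[of n y i] y z[OF that] that by auto
    have kk: "kernel n (restrict (y + z) {..<n} - z) = kernel n y" by (rule kc) simp
    have "restrict (restrict (y + z) {..<n} - z) {..<n} = restrict y {..<n}" by (rule restrict_ext) simp
    then show "restrict (restrict (y + z) {..<n} - z) {..<n} = y" using re y by simp
    show "restrict (y + z) {..<n} \<in> ?Y - {y\<in>?Y. kernel n (y - z) = 0}"
      using y kk mem[of "y + z"] b by auto
  next
    fix y assume y: "y \<in> ?Y - {y\<in>?Y. kernel n (y - z) = 0}"
    have b: "\<bar>y i - z i\<bar> \<le> int (Suc n)" if "i < n" for i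
      using kernel_nonzero[of n "y - z" i] y that by auto
    have kk: "kernel n (restrict (y - z) {..<n}) = kernel n (y - z)" by (rule kc) simp
    have "restrict (restrict (y - z) {..<n} + z) {..<n} = restrict y {..<n}" by (rule restrict_ext) simp
    then show "restrict (restrict (y - z) {..<n} + z) {..<n} = y" using re y by simp
    show "restrict (y - z) {..<n} \<in> ?Y - {y\<in>?Y. kernel n y = 0}"
      using y kk mem[of "y - z"] b by auto
  next
    fix y assume "y \<in> ?Y"
    have "h (x + restrict (y + z) {..<n}) = h (x + z + y)"
      by (rule periodic_cong[OF h]) (simp add: add_ac)
    moreover have "kernel n (restrict (y + z) {..<n} - z) = kernel n y" by (rule kc) simp
    ultimately show "kernel n (restrict (y + z) {..<n} - z) * h (x + restrict (y + z) {..<n}) = kernel n y * h (x + z + y)"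
      by simp
  qed auto
  then show ?thesis by (simp add: smooth_def)
qed

lemma sum_torus_smooth_second_difference_le:
  fixes z :: "nat \<Rightarrow> int"
  assumes M: "0 < M" and h: "periodic M n h" and p: "1 \<le> p" and n: "1 \<le> n"
    and z: "\<And>i. i < n \<Longrightarrow> \<bar>z i\<bar> \<le> 1"
  shows "(\<Sum>x\<in>torus M n. \<bar>smooth n h (x + z) + smooth n h (x - z) - 2 * smooth n h x\<bar> powr p)
    \<le> (22 / real n) powr p * (\<Sum>x\<in>torus M n. \<bar>h x\<bar> powr p)"
proof -
  have e: "smooth n h (x + z) + smooth n h (x - z) - 2 * smooth n h x
      = (\<Sum>y\<in>kernel_box n. (kernel n (y - z) + kernel n (y + z) - 2 * kernel n y) * h (x + y))" for x
    using smooth_shift[OF h z, where x = x] smooth_shift[OF h, where x = x and z = "- z"] z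
    by (simp add: smooth_def sum.distrib sum_subtractf sum_distrib_left algebra_simps)
  show ?thesis unfolding e
    by (rule sum_torus_convolution_le[OF M h p _ kernel_second_difference[OF n z]]) auto
qed

section \<open>Diagonal walks\<close>

text \<open>Unlike \<open>basis_vec\<close> and \<open>sign_restr\<close>, the vectors
  \<open>unit_vec\<close> and \<open>sign_vec\<close> are not \<open>undefined\<close> outside
  {..<n}, so that sums and negatives behave; periodic functions cannot tell the difference.\<close>

definition unit_vec :: "nat \<Rightarrow> nat \<Rightarrow> int" where
  "unit_vec j = (\<lambda>i. if i = j then 1 else 0)"

definition sign_vec :: "nat set \<Rightarrow> (nat \<Rightarrow> int) \<Rightarrow> nat \<Rightarrow> int" where
  "sign_vec S eps = (\<lambda>i. if i \<in> S then eps i else 0)"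

lemma signsD: "eps \<in> signs n \<Longrightarrow> i < n \<Longrightarrow> eps i = 1 \<or> eps i = - 1"
  by (auto simp: signs_def PiE_iff)

lemma sum_signs_flip:
  fixes F :: "(nat \<Rightarrow> int) \<Rightarrow> real"
  assumes s: "\<And>i. i < n \<Longrightarrow> s i = 1 \<or> s i = - 1"
  shows "(\<Sum>eps\<in>signs n. F (restrict (\<lambda>i. eps i * s i) {..<n})) = (\<Sum>eps\<in>signs n. F eps)"
proof (rule sum.reindex_bij_witness[where i = "\<lambda>eps. restrict (\<lambda>i. eps i * s i) {..<n}" and
      j = "\<lambda>eps. restrict (\<lambda>i. eps i * s i) {..<n}"])
  fix eps assume eps: "eps \<in> signs n"
  have ss: "s i * s i = 1" if "i < n" for i using s[OF that] by auto
  have "restrict (\<lambda>i. restrict (\<lambda>i. eps i * s i) {..<n} i * s i) {..<n} = restrict eps {..<n}"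
    by (rule restrict_ext) (simp add: ss mult.assoc)
  also have "\<dots> = eps" using eps by (auto simp: signs_def PiE_iff extensional_restrict)
  finally have e: "restrict (\<lambda>i. restrict (\<lambda>i. eps i * s i) {..<n} i * s i) {..<n} = eps" .
  show "restrict (\<lambda>i. restrict (\<lambda>i. eps i * s i) {..<n} i * s i) {..<n} = eps" "restrict (\<lambda>i. restrict (\<lambda>i. eps i * s i) {..<n} i * s i) {..<n} = eps"
    by (fact e)+
  show "restrict (\<lambda>i. eps i * s i) {..<n} \<in> signs n" "restrict (\<lambda>i. eps i * s i) {..<n} \<in> signs n"
    using signsD[OF eps] s unfolding signs_def by force+
qed auto

text \<open>A point of the cube \<open>[-n, n]\<^sup>n\<close> with coordinates of the parity of \<open>n\<close> is a sum of \<open>n\<close> sign vectors;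
  other parities are repaired by at most \<open>n\<close> coordinate steps.\<close>
lemma sum_signs_disp_le:
  fixes y :: "nat \<Rightarrow> int"
  assumes M: "0 < M" and h: "periodic M n h" and p: "1 \<le> p" and y: "\<And>i. i < n \<Longrightarrow> \<bar>y i\<bar> \<le> int n"
  shows "(\<Sum>s\<in>signs n. disp p M n h (\<lambda>i. s i * y i))
    \<le> 2 powr (p - 1) * (real n powr p * (\<Sum>s\<in>signs n. disp p M n h s)
        + 2 ^ n * real n powr (p - 1) * (\<Sum>j<n. disp p M n h (unit_vec j)))"
proof (cases "n = 0")
  case True
  have "disp p M n h (\<lambda>i. s i * y i) = disp p M n h 0" for s
    by (rule disp_cong[OF h]) (use True in simp)
  then have "disp p M n h (\<lambda>i. s i * y i) = 0" for s by simp
  then show ?thesis using True by (simp add: disp_nonneg sum_nonneg)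
next
  case False
  \<comment> \<open>Coordinate i rises in its first \<open>c i\<close> steps and falls in the
    others, ending at 2 c - n = y - r with parity defect r in {0, 1}. \<open>q s t\<close> is the
    position after t steps, reflected by s, and \<open>u s j\<close> has the defect repaired in the
    coordinates below j.\<close>
  define c where "c = (\<lambda>i. (int n + y i) div 2)"
  define r where "r = (\<lambda>i. (int n + y i) mod 2)"
  define \<sigma> where "\<sigma> = (\<lambda>t i. if int t < c i then 1 else (- 1 :: int))"
  define q where "q = (\<lambda>s t i. s i * (2 * min (int t) (c i) - int t) :: int)"
  define u where "u = (\<lambda>s j i. s i * (y i - r i) + (if i < j then s i * r i else 0) :: int)"
  have cr: "2 * c i + r i = int n + y i" for i by (simp add: c_def r_def)
  have c: "0 \<le> c i" "c i \<le> int n" if "i < n" for i using y[OF that] by (auto simp: c_def)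
  have rr: "r i = 0 \<or> r i = 1" for i unfolding r_def by presburger
  have step: "disp p M n h (\<lambda>i. s i * y i)
     \<le> 2 powr (p - 1) * (real n powr (p - 1) * (\<Sum>t<n. disp p M n h (\<lambda>i. s i * \<sigma> t i))
         + real n powr (p - 1) * (\<Sum>j<n. disp p M n h (unit_vec j)))" if s: "s \<in> signs n" for s
  proof -
    have qn: "h (x + q s n) = h (x + u s 0)" for x
    proof (rule periodic_cong[OF h])
      fix i assume "i < n"
      then have "min (int n) (c i) = c i" using c by simp
      moreover have "2 * c i - int n = y i - r i" using cr[of i] by simp
      ultimately show "(x + q s n) i = (x + u s 0) i" by (simp add: q_def u_def)
    qed
    have q0: "h (x + q s 0) = h x" for x
      by (rule periodic_cong[OF h]) (use c in \<open>auto simp: q_def\<close>)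
    have un: "h (x + u s n) = h (x + (\<lambda>i. s i * y i))" for x
      by (rule periodic_cong[OF h]) (auto simp: u_def algebra_simps)
    have "\<bar>h (x + (\<lambda>i. s i * y i)) - h x\<bar> powr p
        \<le> 2 powr (p - 1) * (\<bar>h (x + q s n) - h (x + q s 0)\<bar> powr p + \<bar>h (x + u s n) - h (x + u s 0)\<bar> powr p)" for x
      using abs_add_powr_le[OF p, of "h (x + q s n) - h (x + q s 0)" "h (x + u s n) - h (x + u s 0)"]
      by (simp add: qn q0 un)
    then have "disp p M n h (\<lambda>i. s i * y i)
      \<le> (\<Sum>x\<in>torus M n. 2 powr (p - 1) * (\<bar>h (x + q s n) - h (x + q s 0)\<bar> powr p + \<bar>h (x + u s n) - h (x + u s 0)\<bar> powr p))"
      unfolding disp_def by (rule sum_mono)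
    also have "\<dots> = 2 powr (p - 1) * ((\<Sum>x\<in>torus M n. \<bar>h (x + q s n) - h (x + q s 0)\<bar> powr p)
        + (\<Sum>x\<in>torus M n. \<bar>h (x + u s n) - h (x + u s 0)\<bar> powr p))"
      by (simp only: sum_distrib_left[symmetric] sum.distrib)
    also have "\<dots> \<le> 2 powr (p - 1) * (real n powr (p - 1) * (\<Sum>t<n. disp p M n h (q s (Suc t) - q s t))
        + real n powr (p - 1) * (\<Sum>j<n. disp p M n h (u s (Suc j) - u s j)))"
      by (intro mult_left_mono add_mono disp_path_le M h p) auto
    also have "\<dots> \<le> 2 powr (p - 1) * (real n powr (p - 1) * (\<Sum>t<n. disp p M n h (\<lambda>i. s i * \<sigma> t i))
         + real n powr (p - 1) * (\<Sum>j<n. disp p M n h (unit_vec j)))"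
    proof -
      have "q s (Suc t) - q s t = (\<lambda>i. s i * \<sigma> t i)" for t
        by (auto simp: fun_eq_iff q_def \<sigma>_def min_def algebra_simps)
      moreover have "disp p M n h (u s (Suc j) - u s j) \<le> disp p M n h (unit_vec j)" if "j < n" for j
      proof -
        have sj: "s j = 1 \<or> s j = - 1" using signsD[OF s that] .
        have d: "u s (Suc j) - u s j = (\<lambda>i. s j * r j * unit_vec j i)"
          by (auto simp: fun_eq_iff u_def unit_vec_def less_Suc_eq)
        consider "s j * r j = 0" | "s j * r j = 1" | "s j * r j = - 1"
          using sj rr[of j] by auto
        then show ?thesis
        proof cases
          case 1
          then have "u s (Suc j) - u s j = 0" by (simp add: d fun_eq_iff)
          then show ?thesis by (simp add: disp_nonneg)
        next
          case 2
          then show ?thesis by (simp add: d)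
        next
          case 3
          then have "u s (Suc j) - u s j = - unit_vec j" by (simp add: d fun_eq_iff)
          then show ?thesis by (simp add: disp_minus[OF M h])
        qed
      qed
      ultimately show ?thesis by (intro mult_left_mono add_mono sum_mono) auto
    qed
    finally show ?thesis .
  qed
  \<comment> \<open>At each time the direction \<open>\<sigma> t\<close> is a sign vector, and
    multiplication by it permutes \<open>signs n\<close>. Summing over s thus makes every step of
    the walk a uniformly random diagonal step.\<close>
  have flip: "(\<Sum>s\<in>signs n. disp p M n h (\<lambda>i. s i * \<sigma> t i)) = (\<Sum>s\<in>signs n. disp p M n h s)" for t
  proof -
    have "(\<Sum>s\<in>signs n. disp p M n h (\<lambda>i. s i * \<sigma> t i)) = (\<Sum>s\<in>signs n. disp p M n h (restrict (\<lambda>i. s i * \<sigma> t i) {..<n}))"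
      by (intro sum.cong refl disp_cong[OF h]) auto
    then show ?thesis using sum_signs_flip[of n "\<sigma> t" "disp p M n h"] by (simp add: \<sigma>_def)
  qed
  have "(\<Sum>s\<in>signs n. disp p M n h (\<lambda>i. s i * y i))
    \<le> (\<Sum>s\<in>signs n. 2 powr (p - 1) * (real n powr (p - 1) * (\<Sum>t<n. disp p M n h (\<lambda>i. s i * \<sigma> t i))
         + real n powr (p - 1) * (\<Sum>j<n. disp p M n h (unit_vec j))))"
    by (intro sum_mono step)
  also have "\<dots> = 2 powr (p - 1) * (real n powr (p - 1) * (\<Sum>t<n. \<Sum>s\<in>signs n. disp p M n h (\<lambda>i. s i * \<sigma> t i))
         + 2 ^ n * (real n powr (p - 1) * (\<Sum>j<n. disp p M n h (unit_vec j))))"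
    by (subst sum.swap[of _ "signs n" "{..<n}"]) (simp add: sum_distrib_left[symmetric] sum.distrib)
  also have "\<dots> = 2 powr (p - 1) * ((real n powr (p - 1) * real n) * (\<Sum>s\<in>signs n. disp p M n h s)
         + 2 ^ n * real n powr (p - 1) * (\<Sum>j<n. disp p M n h (unit_vec j)))"
    by (simp add: flip)
  also have "real n powr (p - 1) * real n = real n powr p"
    using False by (simp add: powr_diff)
  finally show ?thesis .
qed

lemma sum_kernel_flip:
  fixes F :: "(nat \<Rightarrow> int) \<Rightarrow> real"
  assumes s: "\<And>i. i < n \<Longrightarrow> s i = 1 \<or> s i = - 1"
    and F: "\<And>v w. (\<And>i. i < n \<Longrightarrow> v i = w i) \<Longrightarrow> F v = F w"
  shows "(\<Sum>y\<in>kernel_box n. kernel n y * F (\<lambda>i. s i * y i)) = (\<Sum>y\<in>kernel_box n. kernel n y * F y)"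
proof (rule sum.reindex_bij_witness[where i = "\<lambda>y. restrict (\<lambda>i. s i * y i) {..<n}" and
      j = "\<lambda>y. restrict (\<lambda>i. s i * y i) {..<n}"])
  fix y assume y: "y \<in> kernel_box n"
  have ss: "s i * (s i * a) = a" if "i < n" for i a using s[OF that] by auto
  have "restrict (\<lambda>i. s i * restrict (\<lambda>i. s i * y i) {..<n} i) {..<n} = restrict y {..<n}"
    by (rule restrict_ext) (simp add: ss)
  also have "\<dots> = y" using y by (auto simp: kernel_box_def PiE_iff extensional_restrict)
  finally have e: "restrict (\<lambda>i. s i * restrict (\<lambda>i. s i * y i) {..<n} i) {..<n} = y" .
  show "restrict (\<lambda>i. s i * restrict (\<lambda>i. s i * y i) {..<n} i) {..<n} = y" "restrict (\<lambda>i. s i * restrict (\<lambda>i. s i * y i) {..<n} i) {..<n} = y"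
    by (fact e)+
  have "s i * y i \<in> {- int (Suc n)..int (Suc n)}" if "i < n" for i
  proof -
    have "y i \<in> {- int (Suc n)..int (Suc n)}" using y that by (auto simp: kernel_box_def PiE_iff)
    then show ?thesis using s[OF that] by auto
  qed
  then show "restrict (\<lambda>i. s i * y i) {..<n} \<in> kernel_box n" "restrict (\<lambda>i. s i * y i) {..<n} \<in> kernel_box n"
    by (auto simp: kernel_box_def)
  have "kernel n (restrict (\<lambda>i. s i * y i) {..<n}) = kernel n y"
    unfolding kernel_def
  proof (rule prod.cong[OF refl])
    fix i assume "i \<in> {..<n}"
    then show "(tent n (restrict (\<lambda>i. s i * y i) {..<n} i))\<^sup>2 / tent_mass n = (tent n (y i))\<^sup>2 / tent_mass n"
      using s[of i] by (auto simp: tent_def)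
  qed
  moreover have "F (restrict (\<lambda>i. s i * y i) {..<n}) = F (\<lambda>i. s i * y i)"
    by (rule F) simp
  ultimately show "kernel n (restrict (\<lambda>i. s i * y i) {..<n}) * F (restrict (\<lambda>i. s i * y i) {..<n}) = kernel n y * F (\<lambda>i. s i * y i)"
    by simp
qed

text \<open>The smoothing error is an average of displacements by y. Since the tent is even, the
  kernel is invariant under coordinate reflections, so y may be replaced by s y and averaged over
  all signs s; the factor 2^n counts them.\<close>

lemma smoothing_error_le:
  assumes M: "0 < M" and h: "periodic M n h" and p: "1 \<le> p" and n: "1 \<le> n"
  shows "2 ^ n * (\<Sum>x\<in>torus M n. \<bar>smooth n h x - h x\<bar> powr p)
    \<le> 2 powr (p - 1) * (real n powr p * (\<Sum>s\<in>signs n. disp p M n h s)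
        + 2 ^ n * real n powr (p - 1) * (\<Sum>j<n. disp p M n h (unit_vec j)))" (is "_ \<le> ?R")
proof -
  have pw: "\<bar>smooth n h x - h x\<bar> powr p \<le> (\<Sum>y\<in>kernel_box n. kernel n y * \<bar>h (x + y) - h x\<bar> powr p)" for x
  proof -
    have "smooth n h x - h x = (\<Sum>y\<in>kernel_box n. kernel n y * (h (x + y) - h x))"
      using sum_kernel[OF n] by (simp add: smooth_def right_diff_distrib sum_subtractf sum_distrib_right[symmetric])
    then show ?thesis
      using abs_weighted_sum_powr_le[of "kernel_box n" p "kernel n" 1 "\<lambda>y. h (x + y) - h x"] p sum_kernel[OF n]
      by (simp add: kernel_nonneg)
  qed
  have "(\<Sum>x\<in>torus M n. \<bar>smooth n h x - h x\<bar> powr p)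
     \<le> (\<Sum>x\<in>torus M n. \<Sum>y\<in>kernel_box n. kernel n y * \<bar>h (x + y) - h x\<bar> powr p)"
    by (intro sum_mono pw)
  also have "\<dots> = (\<Sum>y\<in>kernel_box n. kernel n y * disp p M n h y)"
    unfolding disp_def by (subst sum.swap) (simp add: sum_distrib_left)
  finally have "2 ^ n * (\<Sum>x\<in>torus M n. \<bar>smooth n h x - h x\<bar> powr p)
     \<le> (\<Sum>s\<in>signs n. \<Sum>y\<in>kernel_box n. kernel n y * disp p M n h y)" by simp
  also have "\<dots> = (\<Sum>s\<in>signs n. \<Sum>y\<in>kernel_box n. kernel n y * disp p M n h (\<lambda>i. s i * y i))"
  proof (rule sum.cong[OF refl])
    fix s assume s: "s \<in> signs n"
    have "(\<Sum>y\<in>kernel_box n. kernel n y * disp p M n h (\<lambda>i. s i * y i)) = (\<Sum>y\<in>kernel_box n. kernel n y * disp p M n h y)"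
    proof (rule sum_kernel_flip)
      show "s i = 1 \<or> s i = - 1" if "i < n" for i
        using signsD[OF s that] .
    qed (rule disp_cong[OF h])
    then show "(\<Sum>y\<in>kernel_box n. kernel n y * disp p M n h y) = (\<Sum>y\<in>kernel_box n. kernel n y * disp p M n h (\<lambda>i. s i * y i))" ..
  qed
  also have "\<dots> = (\<Sum>y\<in>kernel_box n. kernel n y * (\<Sum>s\<in>signs n. disp p M n h (\<lambda>i. s i * y i)))"
    by (subst sum.swap) (simp add: sum_distrib_left)
  also have "\<dots> \<le> (\<Sum>y\<in>kernel_box n. kernel n y * ?R)"
  proof (rule sum_mono)
    fix y
    show "kernel n y * (\<Sum>s\<in>signs n. disp p M n h (\<lambda>i. s i * y i)) \<le> kernel n y * ?R"
    proof (cases "kernel n y = 0")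
      case False
      then have "\<bar>y i\<bar> \<le> int n" if "i < n" for i using kernel_nonzero[OF False that] by simp
      then show ?thesis by (intro mult_left_mono sum_signs_disp_le M h p kernel_nonneg) auto
    qed simp
  qed
  also have "\<dots> = ?R" using sum_kernel[OF n] by (simp add: sum_distrib_right[symmetric])
  finally show ?thesis .
qed

section \<open>Linearization\<close>

text \<open>The central difference is odd under the reflection of coordinate j, so the sign of a
  flip comes out as a factor.\<close>

definition grad :: "nat \<Rightarrow> ((nat \<Rightarrow> int) \<Rightarrow> real) \<Rightarrow> nat \<Rightarrow> (nat \<Rightarrow> int) \<Rightarrow> real" where
  "grad n h j x = smooth n h (x + unit_vec j) - smooth n h (x - unit_vec j)"

text \<open>The position at which coordinate j is flipped when the coordinates of S pass from -eps
  to eps in increasing order: those below j have already moved, those above have not, and j itself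
  is at 0.\<close>

definition mixed_shift :: "nat set \<Rightarrow> (nat \<Rightarrow> int) \<Rightarrow> nat \<Rightarrow> nat \<Rightarrow> int" where
  "mixed_shift S eps j = sign_vec (S \<inter> {..<j}) eps - sign_vec (S \<inter> {j<..}) eps"

lemma telescoping_sign_flips:
  fixes \<phi> :: "(nat \<Rightarrow> int) \<Rightarrow> real"
  assumes S: "S \<subseteq> {..<n}" and eps: "\<And>i. i \<in> S \<Longrightarrow> eps i = 1 \<or> eps i = - 1"
  shows "\<phi> (x + sign_vec S eps) - \<phi> (x - sign_vec S eps)
    = (\<Sum>j\<in>S. of_int (eps j) * (\<phi> (x + mixed_shift S eps j + unit_vec j) - \<phi> (x + mixed_shift S eps j - unit_vec j)))"
proof -
  define q where "q = (\<lambda>j. sign_vec (S \<inter> {..<j}) eps - sign_vec (S \<inter> {j..}) eps)"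
  have qn: "x + q n = x + sign_vec S eps"
    using S by (auto simp: fun_eq_iff q_def sign_vec_def)
  have q0: "x + q 0 = x - sign_vec S eps"
    by (auto simp: fun_eq_iff q_def sign_vec_def)
  have "\<phi> (x + sign_vec S eps) - \<phi> (x - sign_vec S eps) = (\<Sum>j<n. \<phi> (x + q (Suc j)) - \<phi> (x + q j))"
    by (simp only: qn[symmetric] q0[symmetric] sum_lessThan_telescope[of "\<lambda>j. \<phi> (x + q j)"])
  also have "\<dots> = (\<Sum>j\<in>S. \<phi> (x + q (Suc j)) - \<phi> (x + q j))"
  proof (rule sum.mono_neutral_right)
    have "q (Suc j) = q j" if "j \<notin> S" for j
      using that by (auto simp: fun_eq_iff q_def sign_vec_def less_Suc_eq Suc_le_eq le_less)
    then show "\<forall>j\<in>{..<n} - S. \<phi> (x + q (Suc j)) - \<phi> (x + q j) = 0" by simp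
  qed (use S in auto)
  also have "\<dots> = (\<Sum>j\<in>S. of_int (eps j) * (\<phi> (x + mixed_shift S eps j + unit_vec j) - \<phi> (x + mixed_shift S eps j - unit_vec j)))"
  proof (rule sum.cong[OF refl])
    fix j assume j: "j \<in> S"
    have q1: "q (Suc j) = (\<lambda>i. mixed_shift S eps j i + eps j * unit_vec j i)"
      and q2: "q j = (\<lambda>i. mixed_shift S eps j i - eps j * unit_vec j i)"
      using j by (auto simp: fun_eq_iff q_def mixed_shift_def sign_vec_def unit_vec_def)
    from eps[OF j] show "\<phi> (x + q (Suc j)) - \<phi> (x + q j)
       = of_int (eps j) * (\<phi> (x + mixed_shift S eps j + unit_vec j) - \<phi> (x + mixed_shift S eps j - unit_vec j))"
    proof
      assume e: "eps j = 1"
      have "x + q (Suc j) = x + mixed_shift S eps j + unit_vec j" "x + q j = x + mixed_shift S eps j - unit_vec j"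
        unfolding q1 q2 e by (auto simp: fun_eq_iff)
      then show ?thesis by (simp only: e) simp
    next
      assume e: "eps j = - 1"
      have "x + q (Suc j) = x + mixed_shift S eps j - unit_vec j" "x + q j = x + mixed_shift S eps j + unit_vec j"
        unfolding q1 q2 e by (auto simp: fun_eq_iff)
      then show ?thesis by (simp only: e) simp
    qed
  qed
  finally show ?thesis .
qed

text \<open>Averaging the telescoping sum over the two opposite orders of the coordinates makes the shifts
  symmetric, so that the error of linearization involves second differences of the kernel only.\<close>
lemma linearization_error:
  assumes S: "S \<subseteq> {..<n}" and eps: "\<And>i. i \<in> S \<Longrightarrow> eps i = 1 \<or> eps i = - 1"
  shows "smooth n h (x + sign_vec S eps) - smooth n h (x - sign_vec S eps) - (\<Sum>j\<in>S. of_int (eps j) * grad n h j x)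
    = (\<Sum>j\<in>S. (of_int (eps j) / 2) * (grad n h j (x + mixed_shift S eps j) + grad n h j (x - mixed_shift S eps j) - 2 * grad n h j x))"
proof -
  \<comment> \<open>The opposite order arises from applying the telescoping to -eps and reading the
    path backwards: then \<open>sign_vec\<close> and \<open>mixed_shift\<close> both change
    sign.\<close>
  have m: "mixed_shift S (- eps) j = - mixed_shift S eps j" for j
    by (auto simp: fun_eq_iff mixed_shift_def sign_vec_def)
  have s: "sign_vec S (- eps) = - sign_vec S eps"
    by (auto simp: fun_eq_iff sign_vec_def)
  have eps': "(- eps) i = 1 \<or> (- eps) i = - 1" if "i \<in> S" for i using eps[OF that] by auto
  let ?d = "smooth n h (x + sign_vec S eps) - smooth n h (x - sign_vec S eps)"
  have 1: "?d = (\<Sum>j\<in>S. of_int (eps j) * grad n h j (x + mixed_shift S eps j))"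
    using telescoping_sign_flips[where eps = eps, OF S eps, where \<phi> = "smooth n h" and x = x] by (simp add: grad_def)
  have 2: "?d = (\<Sum>j\<in>S. of_int (eps j) * grad n h j (x - mixed_shift S eps j))"
    using telescoping_sign_flips[where eps = "- eps", OF S eps', where \<phi> = "smooth n h" and x = x]
    by (simp add: grad_def m s sum_negf)
  have "?d - (\<Sum>j\<in>S. of_int (eps j) * grad n h j x) = ?d / 2 + ?d / 2 - (\<Sum>j\<in>S. of_int (eps j) * grad n h j x)" by simp
  also have "\<dots> = (\<Sum>j\<in>S. of_int (eps j) * grad n h j (x + mixed_shift S eps j)) / 2
      + (\<Sum>j\<in>S. of_int (eps j) * grad n h j (x - mixed_shift S eps j)) / 2 - (\<Sum>j\<in>S. of_int (eps j) * grad n h j x)"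
    by (simp only: 1[symmetric] 2[symmetric])
  also have "\<dots> = (\<Sum>j\<in>S. (of_int (eps j) / 2) * (grad n h j (x + mixed_shift S eps j) + grad n h j (x - mixed_shift S eps j) - 2 * grad n h j x))"
    unfolding sum_divide_distrib sum.distrib[symmetric] sum_subtractf[symmetric]
    by (intro sum.cong refl) (simp add: field_simps)
  finally show ?thesis .
qed

lemma grad_eq_smooth: "grad n h j x = smooth n (\<lambda>x. h (x + unit_vec j) - h (x - unit_vec j)) x"
  using smooth_add_arg[of n h x "- unit_vec j"]
  by (simp add: grad_def smooth_diff smooth_add_arg)

lemma sum_torus_diff_le:
  assumes M: "0 < M" and h: "periodic M n h" and p: "1 \<le> p"
  shows "(\<Sum>x\<in>torus M n. \<bar>h (x + v) - h (x - v)\<bar> powr p) \<le> 2 powr p * disp p M n h v"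
proof -
  have "v - - v = (\<lambda>i. int 2 * v i)" by (simp add: fun_eq_iff)
  then show ?thesis
    using sum_torus_disp_shift[OF M h, of v "- v" p] disp_multiple_le[OF M h p, of 2 v] by simp
qed

text \<open>The shift \<open>mixed_shift S eps j\<close> is independent of x and has entries in {-1,
  0, 1}, so the kernel estimate applies to the smoothing of h (x + e_j) - h (x - e_j) and gains 22 /
  n for every j. Hoelder's inequality over S costs |S|^(p-1), and |S|^(p-1) n^(-p) is at most 1 /
  n.\<close>

lemma sum_torus_linearization_error_le:
  assumes M: "0 < M" and h: "periodic M n h" and p: "1 \<le> p" and n: "1 \<le> n"
    and S: "S \<subseteq> {..<n}" and eps: "eps \<in> signs n"
  shows "(\<Sum>x\<in>torus M n. \<bar>smooth n h (x + sign_vec S eps) - smooth n h (x - sign_vec S eps)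
        - (\<Sum>j\<in>S. of_int (eps j) * grad n h j x)\<bar> powr p)
    \<le> real (card S) powr (p - 1) * (22 / real n) powr p * (\<Sum>j\<in>S. disp p M n h (unit_vec j))"
proof -
  have fin: "finite S" using S finite_subset by blast
  have e: "eps i = 1 \<or> eps i = - 1" if "i \<in> S" for i using signsD[OF eps] S that by auto
  let ?z = "mixed_shift S eps"
  have z: "\<bar>?z j i\<bar> \<le> 1" if "i < n" for i j
    using signsD[OF eps that] by (auto simp: mixed_shift_def sign_vec_def)
  let ?r = "\<lambda>j x. grad n h j (x + ?z j) + grad n h j (x - ?z j) - 2 * grad n h j x"
  have pw: "\<bar>\<Sum>j\<in>S. (of_int (eps j) / 2) * ?r j x\<bar> powr p
      \<le> real (card S) powr (p - 1) * (\<Sum>j\<in>S. (1/2) powr p * \<bar>?r j x\<bar> powr p)" for x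
  proof -
    have "\<bar>\<Sum>j\<in>S. (of_int (eps j) / 2) * ?r j x\<bar> powr p
        \<le> real (card S) powr (p - 1) * (\<Sum>j\<in>S. \<bar>(of_int (eps j) / 2) * ?r j x\<bar> powr p)"
      by (intro abs_sum_powr_le fin p) simp
    also have "(\<Sum>j\<in>S. \<bar>(of_int (eps j) / 2) * ?r j x\<bar> powr p) = (\<Sum>j\<in>S. (1/2) powr p * \<bar>?r j x\<bar> powr p)"
    proof (rule sum.cong[OF refl])
      fix j assume "j \<in> S"
      then have "\<bar>real_of_int (eps j) / 2\<bar> = 1/2" using e by fastforce
      then show "\<bar>(of_int (eps j) / 2) * ?r j x\<bar> powr p = (1/2) powr p * \<bar>?r j x\<bar> powr p"
        by (simp only: abs_mult powr_mult)
    qed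
    finally show ?thesis .
  qed
  have bound: "(\<Sum>x\<in>torus M n. \<bar>?r j x\<bar> powr p) \<le> (22 / real n) powr p * (2 powr p * disp p M n h (unit_vec j))" for j
  proof -
    have "(\<Sum>x\<in>torus M n. \<bar>?r j x\<bar> powr p)
       \<le> (22 / real n) powr p * (\<Sum>x\<in>torus M n. \<bar>h (x + unit_vec j) - h (x - unit_vec j)\<bar> powr p)"
      unfolding grad_eq_smooth
    proof (rule sum_torus_smooth_second_difference_le[OF M _ p n z])
      show "periodic M n (\<lambda>x. h (x + unit_vec j) - h (x - unit_vec j))"
        using periodic_map2[OF periodic_shift[OF h, of "unit_vec j"] periodic_shift[OF h, of "- unit_vec j"], where F = "(-)"]
        by simp
    qed
    also have "\<dots> \<le> (22 / real n) powr p * (2 powr p * disp p M n h (unit_vec j))"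
      by (intro mult_left_mono sum_torus_diff_le M h p) simp
    finally show ?thesis .
  qed
  have "(\<Sum>x\<in>torus M n. \<bar>smooth n h (x + sign_vec S eps) - smooth n h (x - sign_vec S eps)
        - (\<Sum>j\<in>S. of_int (eps j) * grad n h j x)\<bar> powr p)
      \<le> (\<Sum>x\<in>torus M n. real (card S) powr (p - 1) * (\<Sum>j\<in>S. (1/2) powr p * \<bar>?r j x\<bar> powr p))"
  proof (rule sum_mono)
    fix x
    have "smooth n h (x + sign_vec S eps) - smooth n h (x - sign_vec S eps) - (\<Sum>j\<in>S. of_int (eps j) * grad n h j x)
        = (\<Sum>j\<in>S. (of_int (eps j) / 2) * ?r j x)"
      by (rule linearization_error[OF S]) (rule e)
    then show "\<bar>smooth n h (x + sign_vec S eps) - smooth n h (x - sign_vec S eps) - (\<Sum>j\<in>S. of_int (eps j) * grad n h j x)\<bar> powr p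
        \<le> real (card S) powr (p - 1) * (\<Sum>j\<in>S. (1/2) powr p * \<bar>?r j x\<bar> powr p)"
      using pw[of x] by (simp only:)
  qed
  also have "\<dots> = real (card S) powr (p - 1) * (\<Sum>j\<in>S. (1/2) powr p * (\<Sum>x\<in>torus M n. \<bar>?r j x\<bar> powr p))"
    by (simp only: sum_distrib_left[symmetric] sum.swap[of _ S "torus M n"])
  also have "\<dots> \<le> real (card S) powr (p - 1) * (\<Sum>j\<in>S. (1/2) powr p * ((22 / real n) powr p * (2 powr p * disp p M n h (unit_vec j))))"
    by (intro mult_left_mono sum_mono bound) auto
  also have "\<dots> = real (card S) powr (p - 1) * (\<Sum>j\<in>S. (((1/2) powr p * 2 powr p) * (22 / real n) powr p) * disp p M n h (unit_vec j))"
    by (simp only: mult_ac)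
  \<comment> \<open>The 1/2 comes from averaging two orders, the 2 from the central difference
    spanning two unit steps.\<close>
  also have "(1/2) powr p * 2 powr p = (1::real)"
    by (simp flip: powr_mult)
  finally show ?thesis by (simp only: sum_distrib_left[symmetric] mult_1_left mult.assoc)
qed

section \<open>Moments of gradient sums over random subsets\<close>

lemma sum_torus_grad_le:
  assumes M: "0 < M" and h: "periodic M n h" and p: "1 \<le> p" and n: "1 \<le> n"
  shows "(\<Sum>x\<in>torus M n. \<bar>grad n h j x\<bar> powr p) \<le> 2 powr p * disp p M n h (unit_vec j)"
proof -
  have "(\<Sum>x\<in>torus M n. \<bar>grad n h j x\<bar> powr p) \<le> disp p M n h (unit_vec j - - unit_vec j)"
    using disp_smooth_le[OF M h p n, of "unit_vec j" "- unit_vec j"] by (simp add: grad_def)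
  also have "\<dots> = (\<Sum>x\<in>torus M n. \<bar>h (x + unit_vec j) - h (x - unit_vec j)\<bar> powr p)"
    using sum_torus_disp_shift[OF M h, of "unit_vec j" "- unit_vec j" p] by simp
  also have "\<dots> \<le> 2 powr p * disp p M n h (unit_vec j)" by (rule sum_torus_diff_le[OF M h p])
  finally show ?thesis .
qed

lemma sum_torus_sign_sum_grad_le:
  assumes M: "0 < M" and h: "periodic M n h" and p: "1 \<le> p" and n: "1 \<le> n"
  shows "(\<Sum>eps\<in>signs n. \<Sum>x\<in>torus M n. \<bar>\<Sum>j<n. of_int (eps j) * grad n h j x\<bar> powr p)
    \<le> 2 powr (p - 1) * (2 powr p * (\<Sum>s\<in>signs n. disp p M n h s)
        + 2 ^ n * (22 powr p / real n * (\<Sum>j<n. disp p M n h (unit_vec j))))"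
proof -
  let ?D = "\<Sum>j<n. disp p M n h (unit_vec j)"
  let ?g = "\<lambda>eps x. \<Sum>j<n. of_int (eps j) * grad n h j x"
  let ?d = "\<lambda>eps x. smooth n h (x + sign_vec {..<n} eps) - smooth n h (x - sign_vec {..<n} eps)"
  have c: "real (card {..<n}) powr (p - 1) * (22 / real n) powr p = 22 powr p / real n"
    using n by (simp add: powr_divide powr_diff)
  have "(\<Sum>x\<in>torus M n. \<bar>?g eps x\<bar> powr p) \<le> 2 powr (p - 1) * (2 powr p * disp p M n h eps + 22 powr p / real n * ?D)"
    if eps: "eps \<in> signs n" for eps
  proof -
    have "\<bar>?g eps x\<bar> powr p \<le> 2 powr (p - 1) * (\<bar>?d eps x\<bar> powr p + \<bar>?d eps x - ?g eps x\<bar> powr p)" for x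
      using abs_add_powr_le[OF p, of "?d eps x" "- (?d eps x - ?g eps x)"] by (simp add: abs_minus_commute)
    then have "(\<Sum>x\<in>torus M n. \<bar>?g eps x\<bar> powr p)
       \<le> (\<Sum>x\<in>torus M n. 2 powr (p - 1) * (\<bar>?d eps x\<bar> powr p + \<bar>?d eps x - ?g eps x\<bar> powr p))"
      by (rule sum_mono)
    also have "\<dots> = 2 powr (p - 1) * ((\<Sum>x\<in>torus M n. \<bar>?d eps x\<bar> powr p) + (\<Sum>x\<in>torus M n. \<bar>?d eps x - ?g eps x\<bar> powr p))"
      by (simp only: sum_distrib_left[symmetric] sum.distrib)
    also have "\<dots> \<le> 2 powr (p - 1) * (2 powr p * disp p M n h eps + 22 powr p / real n * ?D)"
    proof (intro mult_left_mono add_mono)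
      have "(\<Sum>x\<in>torus M n. \<bar>?d eps x\<bar> powr p) \<le> disp p M n h (sign_vec {..<n} eps - - sign_vec {..<n} eps)"
        using disp_smooth_le[OF M h p n, of "sign_vec {..<n} eps" "- sign_vec {..<n} eps"] by simp
      also have "\<dots> = disp p M n h (\<lambda>i. int 2 * eps i)"
        by (rule disp_cong[OF h]) (simp add: sign_vec_def)
      also have "\<dots> \<le> 2 powr p * disp p M n h eps"
        using disp_multiple_le[OF M h p, of 2 eps] by simp
      finally show "(\<Sum>x\<in>torus M n. \<bar>?d eps x\<bar> powr p) \<le> 2 powr p * disp p M n h eps" .
      show "(\<Sum>x\<in>torus M n. \<bar>?d eps x - ?g eps x\<bar> powr p) \<le> 22 powr p / real n * ?D"
        using sum_torus_linearization_error_le[OF M h p n subset_refl eps] unfolding c .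
    qed simp
    finally show ?thesis .
  qed
  then have "(\<Sum>eps\<in>signs n. \<Sum>x\<in>torus M n. \<bar>?g eps x\<bar> powr p)
     \<le> (\<Sum>eps\<in>signs n. 2 powr (p - 1) * (2 powr p * disp p M n h eps + 22 powr p / real n * ?D))"
    by (rule sum_mono)
  also have "\<dots> = 2 powr (p - 1) * (2 powr p * (\<Sum>s\<in>signs n. disp p M n h s) + 2 ^ n * (22 powr p / real n * ?D))"
    by (simp only: sum_distrib_left[symmetric] sum.distrib) (simp add: mult.assoc)
  finally show ?thesis .
qed

text \<open>Rosenthal's inequality is used at each fixed x with coefficients
  \<open>grad n h j x\<close>. Smoothing is a contraction, so the moment term returns to h directly;
  the variance term returns through the signed sum over all coordinates.\<close>

lemma sum_subsets_sign_sum_grad_le: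
  assumes M: "0 < M" and h: "periodic M n h" and p: "2 \<le> p" and k: "1 \<le> k" "k \<le> n"
  shows "(\<Sum>S | S \<subseteq> {..<n} \<and> card S = k. \<Sum>eps\<in>signs n. \<Sum>x\<in>torus M n. \<bar>\<Sum>j\<in>S. of_int (eps j) * grad n h j x\<bar> powr p)
    \<le> real (n choose k) * (4 * (p / ln p)) powr p *
      (88 powr p * (real k / real n * (2 ^ n * (\<Sum>j<n. disp p M n h (unit_vec j)))
        + (real k / real n) powr (p / 2) * (\<Sum>s\<in>signs n. disp p M n h s)))"
proof -
  define \<alpha> where "\<alpha> = real k / real n"
  define D where "D = 2 ^ n * (\<Sum>j<n. disp p M n h (unit_vec j))"
  define B where "B = (\<Sum>s\<in>signs n. disp p M n h s)"
  define C where "C = real (n choose k) * (4 * (p / ln p)) powr p"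
  let ?G = "\<lambda>x. \<Sum>j<n. \<bar>grad n h j x\<bar> powr p"
  let ?Q = "\<lambda>x. \<Sum>eps\<in>signs n. \<bar>\<Sum>j<n. of_int (eps j) * grad n h j x\<bar> powr p"
  have n: "1 \<le> n" and p1: "1 \<le> p" using k p by auto
  have \<alpha>: "0 \<le> \<alpha>" "\<alpha> \<le> 1" "1 / real n \<le> \<alpha>" using k by (auto simp: \<alpha>_def divide_right_mono)
  have D0: "0 \<le> D" "0 \<le> B" "0 \<le> C" by (auto simp: D_def B_def C_def intro!: mult_nonneg_nonneg sum_nonneg disp_nonneg)
  have "(\<Sum>S | S \<subseteq> {..<n} \<and> card S = k. \<Sum>eps\<in>signs n. \<Sum>x\<in>torus M n. \<bar>\<Sum>j\<in>S. of_int (eps j) * grad n h j x\<bar> powr p)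
     = (\<Sum>x\<in>torus M n. \<Sum>S | S \<subseteq> {..<n} \<and> card S = k. \<Sum>eps\<in>signs n. \<bar>\<Sum>j\<in>S. of_int (eps j) * grad n h j x\<bar> powr p)"
    by (simp only: sum.swap[of _ "torus M n" "signs n"]) (rule sum.swap)
  also have "\<dots> \<le> (\<Sum>x\<in>torus M n. C * (\<alpha> * (2 ^ n * ?G x) + \<alpha> powr (p / 2) * ?Q x))"
  proof (rule sum_mono)
    fix x
    have "(\<Sum>S | S \<subseteq> {..<n} \<and> card S = k. \<Sum>eps\<in>signs n. \<bar>\<Sum>j\<in>S. of_int (eps j) * grad n h j x\<bar> powr p)
       \<le> real (n choose k) * 2 ^ n * (4 * (p / ln p)) powr p
          * (\<alpha> * ?G x + \<alpha> powr (p / 2) * (\<Sum>j<n. (grad n h j x)\<^sup>2) powr (p / 2))"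
      using Rosenthal_subset[OF k p, of "\<lambda>j. grad n h j x"] by (simp add: \<alpha>_def)
    also have "\<dots> = C * (\<alpha> * (2 ^ n * ?G x) + \<alpha> powr (p / 2) * (2 ^ n * (\<Sum>j<n. (grad n h j x)\<^sup>2) powr (p / 2)))"
      by (simp add: C_def algebra_simps)
    also have "\<dots> \<le> C * (\<alpha> * (2 ^ n * ?G x) + \<alpha> powr (p / 2) * ?Q x)"
      by (intro mult_left_mono add_left_mono sum_squares_powr_le_sum_signs p D0) auto
    finally show "(\<Sum>S | S \<subseteq> {..<n} \<and> card S = k. \<Sum>eps\<in>signs n. \<bar>\<Sum>j\<in>S. of_int (eps j) * grad n h j x\<bar> powr p)
       \<le> C * (\<alpha> * (2 ^ n * ?G x) + \<alpha> powr (p / 2) * ?Q x)" .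
  qed
  also have "\<dots> = C * (\<alpha> * (2 ^ n * (\<Sum>j<n. \<Sum>x\<in>torus M n. \<bar>grad n h j x\<bar> powr p))
      + \<alpha> powr (p / 2) * (\<Sum>eps\<in>signs n. \<Sum>x\<in>torus M n. \<bar>\<Sum>j<n. of_int (eps j) * grad n h j x\<bar> powr p))"
    by (simp only: sum_distrib_left[symmetric] sum.distrib sum.swap[of _ "{..<n}" "torus M n"] sum.swap[of _ "signs n" "torus M n"])
  also have "\<dots> \<le> C * (\<alpha> * (2 ^ n * (\<Sum>j<n. 2 powr p * disp p M n h (unit_vec j)))
      + \<alpha> powr (p / 2) * (2 powr (p - 1) * (2 powr p * B + 2 ^ n * (22 powr p / real n * (\<Sum>j<n. disp p M n h (unit_vec j))))))"
    unfolding B_def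
    by (intro mult_left_mono add_mono sum_mono sum_torus_grad_le sum_torus_sign_sum_grad_le M h p1 n D0 \<alpha>) auto
  also have "\<dots> = C * (2 powr p * (\<alpha> * D) + 2 powr (p - 1) * 2 powr p * (\<alpha> powr (p / 2) * B)
      + 2 powr (p - 1) * 22 powr p * (\<alpha> powr (p / 2) * (1 / real n) * D))"
    by (simp add: D_def sum_distrib_left[symmetric] algebra_simps)
  \<comment> \<open>The backward linearization left an error with the factor 1 / n; as 1 / n <=
    \<alpha> and \<alpha>^(p/2) <= 1, it merges into the coordinate term.\<close>
  also have "\<dots> \<le> C * (2 powr p * (\<alpha> * D) + 2 powr p * 2 powr p * (\<alpha> powr (p / 2) * B)
      + 2 powr p * 22 powr p * (1 * \<alpha> * D))"
    by (intro mult_left_mono add_mono mult_right_mono powr_mono mult_mono powr_le1) (use \<alpha> D0 p in auto)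
  also have "\<dots> = C * ((2 powr p + 44 powr p) * (\<alpha> * D) + 4 powr p * (\<alpha> powr (p / 2) * B))"
    by (simp add: powr_mult[symmetric] algebra_simps)
  also have "\<dots> \<le> C * (88 powr p * (\<alpha> * D) + 88 powr p * (\<alpha> powr (p / 2) * B))"
  proof (intro mult_left_mono add_mono mult_right_mono)
    have "2 powr p \<le> (44::real) powr p" using p by (intro powr_mono2) auto
    moreover have "2 * 44 powr p \<le> 2 powr p * (44::real) powr p"
      using two_le_two_powr[OF p1] by (intro mult_right_mono) auto
    moreover have "2 powr p * (44::real) powr p = 88 powr p" by (simp flip: powr_mult)
    ultimately show "2 powr p + 44 powr p \<le> (88::real) powr p" by linarith
    show "4 powr p \<le> (88::real) powr p" using p by (intro powr_mono2) auto
  qed (use \<alpha> D0 in auto)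
  finally show ?thesis unfolding C_def \<alpha>_def D_def B_def by (simp only: distrib_left[symmetric])
qed

lemma sum_subsets_linearization_error_le:
  assumes M: "0 < M" and h: "periodic M n h" and p: "1 \<le> p" and k: "1 \<le> k" "k \<le> n"
  shows "(\<Sum>S | S \<subseteq> {..<n} \<and> card S = k. \<Sum>eps\<in>signs n.
      \<Sum>x\<in>torus M n. \<bar>smooth n h (x + sign_vec S eps) - smooth n h (x - sign_vec S eps)
        - (\<Sum>j\<in>S. of_int (eps j) * grad n h j x)\<bar> powr p)
    \<le> real (n choose k) * (22 powr p * (real k / real n * (2 ^ n * (\<Sum>j<n. disp p M n h (unit_vec j)))))"
proof -
  have n: "1 \<le> n" using k by simp
  let ?e = "\<lambda>S. (\<Sum>j\<in>S. disp p M n h (unit_vec j))"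
  have c: "real k powr (p - 1) * (22 / real n) powr p \<le> 22 powr p"
  proof -
    have "real k powr (p - 1) \<le> real n powr (p - 1)" using k p by (intro powr_mono2) auto
    also have "\<dots> \<le> real n powr p" using n by (intro powr_mono) auto
    finally have "real k powr (p - 1) * (22 / real n) powr p \<le> real n powr p * (22 / real n) powr p"
      by (intro mult_right_mono) auto
    also have "\<dots> = 22 powr p" using n by (simp flip: powr_mult)
    finally show ?thesis .
  qed
  have "(\<Sum>S | S \<subseteq> {..<n} \<and> card S = k. \<Sum>eps\<in>signs n.
      \<Sum>x\<in>torus M n. \<bar>smooth n h (x + sign_vec S eps) - smooth n h (x - sign_vec S eps)
        - (\<Sum>j\<in>S. of_int (eps j) * grad n h j x)\<bar> powr p)
     \<le> (\<Sum>S | S \<subseteq> {..<n} \<and> card S = k. \<Sum>eps\<in>signs n. 22 powr p * ?e S)"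
  proof (intro sum_mono)
    fix S eps assume S: "S \<in> {S. S \<subseteq> {..<n} \<and> card S = k}" and eps: "eps \<in> signs n"
    have "(\<Sum>x\<in>torus M n. \<bar>smooth n h (x + sign_vec S eps) - smooth n h (x - sign_vec S eps)
        - (\<Sum>j\<in>S. of_int (eps j) * grad n h j x)\<bar> powr p)
       \<le> real k powr (p - 1) * (22 / real n) powr p * ?e S"
      using sum_torus_linearization_error_le[OF M h p n _ eps, of S] S by simp
    also have "\<dots> \<le> 22 powr p * ?e S"
      by (intro mult_right_mono c sum_nonneg disp_nonneg)
    finally show "(\<Sum>x\<in>torus M n. \<bar>smooth n h (x + sign_vec S eps) - smooth n h (x - sign_vec S eps)
        - (\<Sum>j\<in>S. of_int (eps j) * grad n h j x)\<bar> powr p) \<le> 22 powr p * ?e S" .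
  qed
  also have "\<dots> = 2 ^ n * 22 powr p * (\<Sum>S | S \<subseteq> {..<n} \<and> card S = k. ?e S)"
    by (simp add: sum_distrib_left mult.assoc)
  also have "(\<Sum>S | S \<subseteq> {..<n} \<and> card S = k. ?e S) = real (n choose k) * (real k / real n) * (\<Sum>j<n. disp p M n h (unit_vec j))"
    using sum_subsets_sum[of "{..<n}" k "\<lambda>j. disp p M n h (unit_vec j)"] k by simp
  finally show ?thesis by (simp only: mult_ac)
qed

section \<open>The inequality\<close>

lemma scalar_metric_Xp_unnormalized:
  assumes p: "2 \<le> p" and k: "1 \<le> k" "k \<le> n" and h: "periodic (4 * m) n h"
    and m: "real n powr (3/2) * ln p / sqrt (real k) + p * real n \<le> real m"
  shows "(\<Sum>S | S \<subseteq> {..<n} \<and> card S = k. \<Sum>eps\<in>signs n. disp p (4 * m) n h (\<lambda>i. 2 * int m * sign_vec S eps i))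
    \<le> real (n choose k) * real m powr p * (6336 * (p / ln p)) powr p
      * (real k / real n * (2 ^ n * (\<Sum>j<n. disp p (4 * m) n h (unit_vec j)))
        + (real k / real n) powr (p / 2) * (\<Sum>s\<in>signs n. disp p (4 * m) n h s))"
proof -
  define M where "M = 4 * m"
  define \<alpha> where "\<alpha> = real k / real n"
  define D where "D = 2 ^ n * (\<Sum>j<n. disp p M n h (unit_vec j))"
  define B where "B = (\<Sum>s\<in>signs n. disp p M n h s)"
  define T where "T = \<alpha> * D + \<alpha> powr (p / 2) * B"
  define q where "q = p / ln p"
  define E where "E = (\<Sum>x\<in>torus M n. \<bar>smooth n h x - h x\<bar> powr p)"
  define C where "C = real (n choose k)"
  have h: "periodic M n h" using h by (simp add: M_def)
  have n: "1 \<le> n" and p1: "1 \<le> p" and n1: "1 \<le> real n" using k p by auto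
  have \<alpha>: "0 \<le> \<alpha>" "\<alpha> \<le> 1" "1 / real n \<le> \<alpha>" using k by (auto simp: \<alpha>_def divide_right_mono)
  have lnp: "1 / 2 \<le> ln p"
  proof -
    have "1 / 2 \<le> ln (2::real)" using ln_le_minus_one[of "1/2::real"] by (simp add: ln_div)
    also have "\<dots> \<le> ln p" using p by simp
    finally show ?thesis .
  qed
  have "ln p \<le> p" using ln_le_minus_one[of p] p by linarith
  moreover have "0 < ln p" using lnp by linarith
  ultimately have q1: "1 \<le> q" by (simp add: q_def le_divide_eq_1_pos)
  have D0: "0 \<le> D" "0 \<le> B" "0 \<le> C" by (auto simp: D_def B_def C_def intro!: mult_nonneg_nonneg sum_nonneg disp_nonneg)
  have T0: "0 \<le> T" using D0 \<alpha> by (simp add: T_def)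
  have DT: "\<alpha> * D \<le> T" "\<alpha> powr (p / 2) * B \<le> T" using D0 \<alpha> by (auto simp: T_def)
  \<comment> \<open>The two uses of the lower bound on m. Its first summand is n ln p / sqrt
    \<alpha>, and with ln p >= 1/2 it yields n <= 2 m sqrt \<alpha>, which pays for the diagonal
    steps with weight \<alpha>^(p/2). The summand p n yields n <= m, which pays for the coordinate
    steps.\<close>
  have nm: "real n \<le> real m" and nm2: "real n \<le> real m * (2 * sqrt \<alpha>)"
  proof -
    have a: "0 \<le> real n powr (3/2) * ln p / sqrt (real k)" using lnp by simp
    have "1 * real n \<le> p * real n" using p1 by (intro mult_right_mono) auto
    with a m show "real n \<le> real m" by linarith
    have n32: "real n powr (3/2) = real n * sqrt (real n)"
      using n1 powr_add[of "real n" 1 "1/2"] by (simp add: powr_half_sqrt)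
    have "real n * sqrt (real n) * (1/2) / sqrt (real k) \<le> real n powr (3/2) * ln p / sqrt (real k)"
      unfolding n32 using lnp by (intro divide_right_mono mult_left_mono) auto
    also have "\<dots> \<le> real m" using m p by (smt (verit) mult_nonneg_nonneg of_nat_0_le_iff)
    finally have "real n * sqrt (real n) * (1/2) / sqrt (real k) * (2 * sqrt \<alpha>) \<le> real m * (2 * sqrt \<alpha>)"
      by (rule mult_right_mono) (use \<alpha> in simp)
    moreover have "real n * sqrt (real n) * (1/2) / sqrt (real k) * (2 * sqrt \<alpha>) = real n"
      using k by (simp add: \<alpha>_def real_sqrt_divide)
    ultimately show "real n \<le> real m * (2 * sqrt \<alpha>)" by simp
  qed
  have m0: "0 < real m" "0 < M" using nm n1 by (auto simp: M_def)
  have np: "real n powr p \<le> real m powr p * (2 powr p * \<alpha> powr (p / 2))"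
  proof -
    have "real n powr p \<le> (real m * (2 * sqrt \<alpha>)) powr p" using nm2 p by (intro powr_mono2) auto
    also have "\<dots> = real m powr p * (2 powr p * \<alpha> powr (p / 2))"
      using \<alpha> by (simp add: powr_mult powr_half_sqrt[symmetric] powr_powr)
    finally show ?thesis .
  qed
  \<comment> \<open>The path of coordinate steps costs n^(p-1) rather than n^p, and the missing
    factor 1 / n supplies the weight \<alpha>.\<close>
  have np1: "real n powr (p - 1) \<le> real m powr p * \<alpha>"
  proof -
    have "real n powr (p - 1) = real n powr p * (1 / real n)" using n1 by (simp add: powr_diff)
    also have "\<dots> \<le> real m powr p * \<alpha>" using nm p \<alpha> by (intro mult_mono powr_mono2) auto
    finally show ?thesis .
  qed
  define X where "X = 2 ^ n * E"
  have X: "X \<le> 4 powr p * real m powr p * T"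
  proof -
    have "X \<le> 2 powr (p - 1) * (real n powr p * B + real n powr (p - 1) * D)"
      using smoothing_error_le[OF m0(2) h p1 n] by (simp add: X_def E_def B_def D_def algebra_simps)
    also have "\<dots> \<le> 2 powr p * (real m powr p * (2 powr p * \<alpha> powr (p / 2)) * B + real m powr p * \<alpha> * D)"
      by (intro mult_mono add_mono mult_right_mono powr_mono np np1) (use D0 in auto)
    also have "\<dots> \<le> 2 powr p * (real m powr p * (2 powr p * \<alpha> powr (p / 2)) * B + real m powr p * (2 powr p * \<alpha>) * D)"
    proof -
      have "1 * \<alpha> \<le> 2 powr p * \<alpha>" using \<alpha> two_le_two_powr[OF p1] by (intro mult_right_mono) auto
      then show ?thesis using D0 by (intro mult_left_mono add_mono mult_right_mono) auto
    qed
    also have "\<dots> = (2 powr p * 2 powr p) * real m powr p * T" by (simp add: T_def algebra_simps)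
    finally show ?thesis by (simp flip: powr_mult)
  qed
  let ?v = "\<lambda>S eps i. 2 * int m * sign_vec S eps i"
  let ?g = "\<lambda>S eps x. \<Sum>j\<in>S. of_int (eps j) * grad n h j x"
  let ?d = "\<lambda>S eps x. smooth n h (x + sign_vec S eps) - smooth n h (x - sign_vec S eps)"
  let ?G = "\<lambda>S eps. \<Sum>x\<in>torus M n. \<bar>?g S eps x\<bar> powr p"
  let ?Err = "\<lambda>S eps. \<Sum>x\<in>torus M n. \<bar>?d S eps x - ?g S eps x\<bar> powr p"
  \<comment> \<open>Both endpoints are replaced by smoothed values, each at cost E by translation
    invariance. The long shift 2 m eps_S consists of m shifts from -eps_S to eps_S, which are
    centred as the linearization requires.\<close>
  have dec: "disp p M n h (?v S eps) \<le> 3 powr (p - 1) * (2 * E + real m powr p * (2 powr (p - 1) * (?G S eps + ?Err S eps)))" for S eps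
  proof -
    have pw: "\<bar>h (x + ?v S eps) - h x\<bar> powr p \<le> 3 powr (p - 1) * (\<bar>smooth n h (x + ?v S eps) - h (x + ?v S eps)\<bar> powr p
        + \<bar>smooth n h x - h x\<bar> powr p + \<bar>smooth n h (x + ?v S eps) - smooth n h x\<bar> powr p)" for x
      using abs_add3_powr_le[OF p1, of "h (x + ?v S eps) - smooth n h (x + ?v S eps)" "smooth n h x - h x" "smooth n h (x + ?v S eps) - smooth n h x"]
      by (simp add: abs_minus_commute)
    have "disp p M n h (?v S eps) \<le> (\<Sum>x\<in>torus M n. 3 powr (p - 1) * (\<bar>smooth n h (x + ?v S eps) - h (x + ?v S eps)\<bar> powr p
        + \<bar>smooth n h x - h x\<bar> powr p + \<bar>smooth n h (x + ?v S eps) - smooth n h x\<bar> powr p))"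
      unfolding disp_def by (rule sum_mono[OF pw])
    also have "\<dots> = 3 powr (p - 1) * ((\<Sum>x\<in>torus M n. \<bar>smooth n h (x + ?v S eps) - h (x + ?v S eps)\<bar> powr p)
        + E + disp p M n (smooth n h) (?v S eps))"
      by (simp only: sum_distrib_left[symmetric] sum.distrib E_def disp_def)
    also have "(\<Sum>x\<in>torus M n. \<bar>smooth n h (x + ?v S eps) - h (x + ?v S eps)\<bar> powr p) = E"
      unfolding E_def
      by (rule sum_torus_shift[OF m0(2), where h = "\<lambda>x. \<bar>smooth n h x - h x\<bar> powr p"])
         (rule periodic_map2[OF periodic_smooth[OF h] h, where F = "\<lambda>u v. \<bar>u - v\<bar> powr p"])
    also have "disp p M n (smooth n h) (?v S eps) \<le> real m powr p * (\<Sum>x\<in>torus M n. \<bar>?d S eps x\<bar> powr p)"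
    proof -
      have "?v S eps = (\<lambda>i. int m * (sign_vec S eps - - sign_vec S eps) i)" by (simp add: fun_eq_iff)
      then have "disp p M n (smooth n h) (?v S eps) \<le> real m powr p * disp p M n (smooth n h) (sign_vec S eps - - sign_vec S eps)"
        using disp_multiple_le[OF m0(2) periodic_smooth[OF h] p1, of m "sign_vec S eps - - sign_vec S eps"] by (simp only:)
      then show ?thesis
        using sum_torus_disp_shift[OF m0(2) periodic_smooth[OF h], of "sign_vec S eps" "- sign_vec S eps" p] by simp
    qed
    also have "(\<Sum>x\<in>torus M n. \<bar>?d S eps x\<bar> powr p) \<le> 2 powr (p - 1) * (?G S eps + ?Err S eps)"
    proof -
      have "\<bar>?d S eps x\<bar> powr p \<le> 2 powr (p - 1) * (\<bar>?g S eps x\<bar> powr p + \<bar>?d S eps x - ?g S eps x\<bar> powr p)" for x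
        using abs_add_powr_le[OF p1, of "?g S eps x" "?d S eps x - ?g S eps x"] by simp
      then have "(\<Sum>x\<in>torus M n. \<bar>?d S eps x\<bar> powr p) \<le> (\<Sum>x\<in>torus M n. 2 powr (p - 1) * (\<bar>?g S eps x\<bar> powr p + \<bar>?d S eps x - ?g S eps x\<bar> powr p))"
        by (rule sum_mono)
      then show ?thesis by (simp only: sum_distrib_left[symmetric] sum.distrib)
    qed
    finally show ?thesis by (simp add: mult_left_mono)
  qed
  have "(\<Sum>S | S \<subseteq> {..<n} \<and> card S = k. \<Sum>eps\<in>signs n. disp p M n h (?v S eps))
     \<le> (\<Sum>S | S \<subseteq> {..<n} \<and> card S = k. \<Sum>eps\<in>signs n. 3 powr (p - 1) * (2 * E + real m powr p * (2 powr (p - 1) * (?G S eps + ?Err S eps))))"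
    by (intro sum_mono dec)
  also have "\<dots> = 3 powr (p - 1) * (C * (2 * X) + real m powr p * (2 powr (p - 1)
      * ((\<Sum>S | S \<subseteq> {..<n} \<and> card S = k. \<Sum>eps\<in>signs n. ?G S eps) + (\<Sum>S | S \<subseteq> {..<n} \<and> card S = k. \<Sum>eps\<in>signs n. ?Err S eps))))"
  proof -
    have "card {S. S \<subseteq> {..<n} \<and> card S = k} = n choose k" using n_subsets[of "{..<n}" k] by simp
    then have "(\<Sum>S | S \<subseteq> {..<n} \<and> card S = k. \<Sum>eps\<in>signs n. 2 * E) = C * (2 * X)"
      by (simp add: C_def X_def)
    then show ?thesis by (simp only: sum_distrib_left[symmetric] sum.distrib)
  qed
  also have "\<dots> \<le> 3 powr p * (C * (2 * (4 powr p * real m powr p * T)) + real m powr p * (2 powr p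
      * (C * (4 * q) powr p * (88 powr p * T) + C * (22 powr p * T))))"
  proof (intro mult_mono add_mono mult_left_mono X powr_mono)
    show "(\<Sum>S | S \<subseteq> {..<n} \<and> card S = k. \<Sum>eps\<in>signs n. ?G S eps) \<le> C * (4 * q) powr p * (88 powr p * T)"
      using sum_subsets_sign_sum_grad_le[OF m0(2) h p k] by (simp only: C_def q_def T_def \<alpha>_def D_def B_def)
    have "(\<Sum>S | S \<subseteq> {..<n} \<and> card S = k. \<Sum>eps\<in>signs n. ?Err S eps) \<le> C * (22 powr p * (\<alpha> * D))"
      using sum_subsets_linearization_error_le[OF m0(2) h p1 k] by (simp only: C_def \<alpha>_def D_def)
    also have "\<dots> \<le> C * (22 powr p * T)" using DT D0 by (intro mult_left_mono) auto
    finally show "(\<Sum>S | S \<subseteq> {..<n} \<and> card S = k. \<Sum>eps\<in>signs n. ?Err S eps) \<le> C * (22 powr p * T)" .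
  qed (use D0 m0 in \<open>auto simp: X_def E_def intro!: add_nonneg_nonneg mult_nonneg_nonneg sum_nonneg\<close>)
  also have "\<dots> = C * real m powr p * T * 3 powr p * (2 * 4 powr p + 2 powr p * (4 powr p * 88 powr p) * q powr p + 2 powr p * 22 powr p)"
    by (simp add: powr_mult algebra_simps)
  \<comment> \<open>Here 704 = 2 * 4 * 88, and q >= 1 lets the terms without q be absorbed. The
    outer factor 3^(p+1) is at most 9^p, and 9 * 704 = 6336.\<close>
  also have "\<dots> \<le> C * real m powr p * T * 3 powr p * ((704 * q) powr p + (704 * q) powr p + (704 * q) powr p)"
  proof (intro mult_left_mono add_mono)
    have "2 * 4 powr p \<le> 2 powr p * (4::real) powr p"
      using two_le_two_powr[OF p1] by (intro mult_right_mono) auto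
    also have "\<dots> = 8 powr p" by (simp flip: powr_mult)
    also have "\<dots> \<le> (704 * q) powr p" using p q1 by (intro powr_mono2) auto
    finally show "2 * 4 powr p \<le> (704 * q) powr p" .
    show "2 powr p * (4 powr p * 88 powr p) * q powr p \<le> (704 * q) powr p" by (simp flip: powr_mult)
    have "2 powr p * 22 powr p = (44::real) powr p" by (simp flip: powr_mult)
    also have "\<dots> \<le> (704 * q) powr p" using p q1 by (intro powr_mono2) auto
    finally show "2 powr p * 22 powr p \<le> (704 * q) powr p" .
  qed (use D0 T0 in auto)
  also have "\<dots> = C * real m powr p * T * 3 powr (p + 1) * (704 * q) powr p"
    by (simp add: powr_add)
  also have "\<dots> \<le> C * real m powr p * T * (9 powr p) * (704 * q) powr p"
  proof -
    have "(3::real) powr (p + 1) \<le> 3 powr (2 * p)" using p by (intro powr_mono) auto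
    also have "\<dots> = 9 powr p" by (simp flip: powr_powr)
    finally show ?thesis using D0 T0 by (intro mult_right_mono mult_left_mono) auto
  qed
  also have "\<dots> = C * real m powr p * (9 powr p * (704 * q) powr p) * T" by (simp only: mult_ac)
  also have "9 powr p * (704 * q) powr p = (6336 * q) powr p" by (simp flip: powr_mult)
  finally show ?thesis by (simp only: C_def q_def T_def \<alpha>_def D_def B_def M_def)
qed

section \<open>Integration over [0,1] and normalization\<close>

lemma set_integral_sum:
  fixes g :: "'i \<Rightarrow> 'a \<Rightarrow> real"
  assumes "\<And>i. i \<in> I \<Longrightarrow> set_integrable M A (g i)"
  shows "set_integrable M A (\<lambda>t. \<Sum>i\<in>I. g i t)"
    and "(LINT t:A|M. \<Sum>i\<in>I. g i t) = (\<Sum>i\<in>I. LINT t:A|M. g i t)"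
proof -
  have e: "indicator A t *\<^sub>R (\<Sum>i\<in>I. g i t) = (\<Sum>i\<in>I. indicator A t *\<^sub>R g i t)" for t
    by (simp add: sum_distrib_left)
  show "set_integrable M A (\<lambda>t. \<Sum>i\<in>I. g i t)"
    using assms unfolding set_integrable_def e by (intro Bochner_Integration.integrable_sum)
  show "(LINT t:A|M. \<Sum>i\<in>I. g i t) = (\<Sum>i\<in>I. LINT t:A|M. g i t)"
    using assms unfolding set_integrable_def set_lebesgue_integral_def e by (intro Bochner_Integration.integral_sum)
qed

lemma set_integrable_diff_powr:
  assumes p: "1 \<le> p" and u: "in_Lp p u" and v: "in_Lp p v"
  shows "set_integrable lborel {0..1} (\<lambda>t. \<bar>u t - v t\<bar> powr p)"
proof (rule set_integrable_bound)
  show "set_integrable lborel {0..1} (\<lambda>t. 2 powr (p - 1) * (\<bar>u t\<bar> powr p + \<bar>v t\<bar> powr p))"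
    using u v by (intro set_integrable_mult_right set_integral_add) (auto simp: in_Lp_def)
  have [measurable]: "u \<in> borel_measurable lborel" "v \<in> borel_measurable lborel"
    using u v by (auto simp: in_Lp_def)
  show "set_borel_measurable lborel {0..1} (\<lambda>t. \<bar>u t - v t\<bar> powr p)"
    unfolding set_borel_measurable_def by measurable
  show "AE t in lborel. t \<in> {0..1} \<longrightarrow> norm (\<bar>u t - v t\<bar> powr p) \<le> norm (2 powr (p - 1) * (\<bar>u t\<bar> powr p + \<bar>v t\<bar> powr p))"
    using abs_add_powr_le[OF p, of "u t" "- v t" for t] by simp
qed

theorem mainTheorem1:
  "\<exists>c::real. c > 0 \<and>
    (\<forall>(p::real) (m::nat) (n::nat) (k::nat) (f :: (nat \<Rightarrow> int) \<Rightarrow> real \<Rightarrow> real).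
      p \<ge> 2 \<longrightarrow> 1 \<le> k \<longrightarrow> k \<le> n \<longrightarrow>
      real m \<ge> real n powr (3/2) * ln p / sqrt (real k) + p * real n \<longrightarrow>
      (\<forall>x\<in>torus (4*m) n. in_Lp p (f x)) \<longrightarrow>
      (p / ln p) powr (-p) / real (n choose k) *
        (\<Sum>S | S \<subseteq> {..<n} \<and> card S = k.
           avg (torus (4*m) n \<times> signs n)
             (\<lambda>(x, eps). Lp_norm_pow p (\<lambda>t. f (tadd (4*m) n x (ivec_scale (2 * int m) (sign_restr n S eps))) t - f x t))
           / real m powr p)
      \<le> c powr p *
        (real k / real n *
           (\<Sum>j<n. avg (torus (4*m) n \<times> signs n)
              (\<lambda>(x, eps). Lp_norm_pow p (\<lambda>t. f (tadd (4*m) n x (basis_vec n j)) t - f x t)))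
         + (real k / real n) powr (p/2) *
           avg (torus (4*m) n \<times> signs n)
              (\<lambda>(x, eps). Lp_norm_pow p (\<lambda>t. f (tadd (4*m) n x eps) t - f x t))))"
proof (intro exI[of _ 6336] conjI allI impI)
  fix p :: real and m n k :: nat and f :: "(nat \<Rightarrow> int) \<Rightarrow> real \<Rightarrow> real"
  assume p: "2 \<le> p" and k: "1 \<le> k" "k \<le> n"
    and m: "real m \<ge> real n powr (3/2) * ln p / sqrt (real k) + p * real n"
    and f: "\<forall>x\<in>torus (4*m) n. in_Lp p (f x)"
  define V where "V = torus (4*m) n \<times> signs n"
  define K where "K = real (card V)"
  \<comment> \<open>The sum over (x, eps) at a fixed t. The shift is a function a of eps, so that
    all three averages of the theorem are instances.\<close>
  define U where "U = (\<lambda>a t. \<Sum>(x, eps)\<in>V. \<bar>f (tadd (4*m) n x (a eps)) t - f x t\<bar> powr p)"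
  define I where "I = (\<lambda>u :: real \<Rightarrow> real. LINT t:{0..1}|lborel. u t)"
  \<comment> \<open>Extends f from the torus to all integer vectors by reduction modulo 4 m, which
    makes it periodic and leaves its values on the torus unchanged.\<close>
  define h where "h = (\<lambda>t v. f (restrict (\<lambda>i. v i mod int (4*m)) {..<n}) t)"
  define \<alpha> where "\<alpha> = real k / real n"
  define q where "q = p / ln p"
  define C where "C = real (n choose k)"
  let ?a = "\<lambda>S eps. ivec_scale (2 * int m) (sign_restr n S eps)" and ?b = "\<lambda>j eps :: nat \<Rightarrow> int. basis_vec n j"
    and ?c = "\<lambda>eps :: nat \<Rightarrow> int. eps"
  have p1: "1 \<le> p" using p by simp
  have lnp: "0 < ln p" using p by simp
  have q0: "0 < q" using p lnp by (simp add: q_def)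
  have C0: "0 < C" using k by (simp add: C_def)
  have m0: "0 < m"
  proof -
    have "0 \<le> real n powr (3/2) * ln p / sqrt (real k)" using lnp by simp
    moreover have "0 < p * real n" using p k by simp
    ultimately show ?thesis using m by linarith
  qed
  have K0: "0 < K" using m0 by (simp add: K_def V_def card_cartesian_product card_torus)
  have tadd_mem: "tadd (4*m) n x v \<in> torus (4*m) n" for x v
    using m0 by (auto simp: tadd_def torus_def)
  have int1: "set_integrable lborel {0..1} (\<lambda>t. case z of (x, eps) \<Rightarrow> \<bar>f (tadd (4*m) n x (a eps)) t - f x t\<bar> powr p)"
    if "z \<in> V" for a z
    using that f tadd_mem by (auto simp: V_def intro!: set_integrable_diff_powr[OF p1])
  have intU: "set_integrable lborel {0..1} (U a)" for a
    unfolding U_def by (rule set_integral_sum(1)) (rule int1)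
  have avgU: "avg V (\<lambda>(x, eps). Lp_norm_pow p (\<lambda>t. f (tadd (4*m) n x (a eps)) t - f x t)) = I (U a) / K" for a
  proof -
    have "I (U a) = (\<Sum>z\<in>V. LINT t:{0..1}|lborel. case z of (x, eps) \<Rightarrow> \<bar>f (tadd (4*m) n x (a eps)) t - f x t\<bar> powr p)"
      unfolding I_def U_def by (rule set_integral_sum(2)) (rule int1)
    also have "\<dots> = (\<Sum>(x, eps)\<in>V. Lp_norm_pow p (\<lambda>t. f (tadd (4*m) n x (a eps)) t - f x t))"
      by (intro sum.cong refl) (auto simp: Lp_norm_pow_def)
    finally show ?thesis by (simp add: avg_def K_def)
  qed
  have per: "periodic (4*m) n (h t)" for t
    unfolding periodic_def h_def by (auto intro!: arg_cong[where f = "\<lambda>x. f x t"] restrict_ext)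
  have U_disp: "U a t = (\<Sum>eps\<in>signs n. disp p (4*m) n (h t) (a eps))" for a t
  proof -
    have hx: "h t x = f x t" if "x \<in> torus (4*m) n" for x
    proof -
      have "restrict (\<lambda>i. x i mod int (4*m)) {..<n} = restrict x {..<n}"
        using that by (intro restrict_ext) (auto simp: torus_def PiE_iff)
      also have "\<dots> = x" using that by (auto simp: torus_def PiE_iff extensional_restrict)
      finally show ?thesis by (simp add: h_def)
    qed
    have "U a t = (\<Sum>x\<in>torus (4*m) n. \<Sum>eps\<in>signs n. \<bar>f (tadd (4*m) n x (a eps)) t - f x t\<bar> powr p)"
      by (simp add: U_def V_def sum.cartesian_product)
    also have "\<dots> = (\<Sum>x\<in>torus (4*m) n. \<Sum>eps\<in>signs n. \<bar>h t (x + a eps) - h t x\<bar> powr p)"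
      by (intro sum.cong refl) (simp add: hx, simp add: h_def tadd_def)
    finally show ?thesis unfolding disp_def by (subst sum.swap)
  qed
  define R where "R = (\<lambda>t. \<alpha> * (\<Sum>j<n. U (?b j) t) + \<alpha> powr (p / 2) * U ?c t)"
  have pw: "(\<Sum>S | S \<subseteq> {..<n} \<and> card S = k. U (?a S) t) \<le> C * real m powr p * (6336 * q) powr p * R t" for t
  proof -
    have "U (?a S) t = (\<Sum>eps\<in>signs n. disp p (4*m) n (h t) (\<lambda>i. 2 * int m * sign_vec S eps i))" for S
      unfolding U_disp by (intro sum.cong refl disp_cong[OF per]) (simp add: ivec_scale_def sign_restr_def sign_vec_def)
    \<comment> \<open>The shift does not depend on eps here, so the sum over signs only contributes
      the factor 2^n that the scalar inequality carries in its coordinate term.\<close>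
    moreover have "(\<Sum>j<n. U (?b j) t) = 2 ^ n * (\<Sum>j<n. disp p (4*m) n (h t) (unit_vec j))"
    proof -
      have "disp p (4*m) n (h t) (basis_vec n j) = disp p (4*m) n (h t) (unit_vec j)" for j
        by (rule disp_cong[OF per]) (simp add: basis_vec_def unit_vec_def)
      then show ?thesis by (simp add: U_disp sum_distrib_left)
    qed
    ultimately show ?thesis
      using scalar_metric_Xp_unnormalized[OF p k per m, of t] by (simp only: R_def U_disp[of ?c] C_def q_def \<alpha>_def)
  qed
  have intR: "set_integrable lborel {0..1} R"
    unfolding R_def by (intro set_integral_add set_integrable_mult_right set_integral_sum(1) intU)
  have IR: "I R = \<alpha> * (\<Sum>j<n. I (U (?b j))) + \<alpha> powr (p / 2) * I (U ?c)"
    unfolding I_def R_def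
    by (simp add: set_integral_add(2) set_integral_sum set_integrable_mult_right intU)
  have "(\<Sum>S | S \<subseteq> {..<n} \<and> card S = k. I (U (?a S))) = I (\<lambda>t. \<Sum>S | S \<subseteq> {..<n} \<and> card S = k. U (?a S) t)"
    unfolding I_def by (rule set_integral_sum(2)[symmetric]) (rule intU)
  also have "\<dots> \<le> I (\<lambda>t. C * real m powr p * (6336 * q) powr p * R t)"
    unfolding I_def
    by (intro set_integral_mono set_integral_sum(1) intU set_integrable_mult_right intR pw)
  also have "\<dots> = C * real m powr p * (6336 * q) powr p * I R"
    by (simp add: I_def)
  finally have main: "(\<Sum>S | S \<subseteq> {..<n} \<and> card S = k. I (U (?a S))) \<le> C * real m powr p * (6336 * q) powr p * I R" .
  have "q powr (-p) / C * (\<Sum>S | S \<subseteq> {..<n} \<and> card S = k. I (U (?a S)) / K / real m powr p)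
      = q powr (-p) / (C * K * real m powr p) * (\<Sum>S | S \<subseteq> {..<n} \<and> card S = k. I (U (?a S)))"
    by (simp add: sum_divide_distrib[symmetric])
  also have "\<dots> \<le> q powr (-p) / (C * K * real m powr p) * (C * real m powr p * (6336 * q) powr p * I R)"
    using C0 K0 by (intro mult_left_mono main) auto
  also have "\<dots> = (q powr (-p) * q powr p) * 6336 powr p * (I R / K)"
    using C0 m0 by (simp add: powr_mult)
  also have "q powr (-p) * q powr p = 1" using q0 by (simp flip: powr_add)
  also have "1 * 6336 powr p * (I R / K) = 6336 powr p * (\<alpha> * (\<Sum>j<n. I (U (?b j)) / K) + \<alpha> powr (p / 2) * (I (U ?c) / K))"
    by (simp add: IR add_divide_distrib sum_divide_distrib[symmetric])
  finally show "(p / ln p) powr (-p) / real (n choose k) *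
        (\<Sum>S | S \<subseteq> {..<n} \<and> card S = k.
           avg (torus (4*m) n \<times> signs n)
             (\<lambda>(x, eps). Lp_norm_pow p (\<lambda>t. f (tadd (4*m) n x (ivec_scale (2 * int m) (sign_restr n S eps))) t - f x t))
           / real m powr p)
      \<le> 6336 powr p *
        (real k / real n *
           (\<Sum>j<n. avg (torus (4*m) n \<times> signs n)
              (\<lambda>(x, eps). Lp_norm_pow p (\<lambda>t. f (tadd (4*m) n x (basis_vec n j)) t - f x t)))
         + (real k / real n) powr (p/2) *
           avg (torus (4*m) n \<times> signs n)
              (\<lambda>(x, eps). Lp_norm_pow p (\<lambda>t. f (tadd (4*m) n x eps) t - f x t)))"
    using avgU[of "?a S" for S] avgU[of "?b j" for j] avgU[of ?c]
    by (simp only: V_def q_def C_def \<alpha>_def)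
qed simp

end
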